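(* Let $b\ge 2$ be an integer. Every nonnegative integer can be written as $2x^2+by^2+(z^2+zw+w^2)$ with $x,y,z,w\in\mathbb{Z}$ if and only if $b\in\{2,3,4,5,6,7,8,9,10\}$. *)

theory Defs
  imports Main
begin

end

theory Submission
  imports Defs "HOL-Number_Theory.Number_Theory" "HOL-Number_Theory.Prime_Powers"
    "HOL-Computational_Algebra.Squarefree" "HOL-Library.Discrete_Functions" "HOL-Analysis.Summation_Tests"
begin

text \<open>
  Write \<open>T\<close> for the ternary form \<open>2x\<^sup>2 + z\<^sup>2 + zw + w\<^sup>2\<close>. It misses 10, so a universal form needs
  \<open>b \<le> 10\<close>. Conversely \<open>T\<close> represents every number that is not of the form \<open>4\<^sup>k(16m + 10)\<close>, and
  from \<open>16m + 10\<close> one of \<open>b\<close>, \<open>4b\<close> can be subtracted to leave a number represented by \<open>T\<close>.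

  For squarefree \<open>n\<close> outside the exceptional class, pick a prime \<open>q \<equiv> 1 (mod 3)\<close> with prescribed
  residue mod 8 and prescribed Legendre symbols at the primes dividing \<open>n\<close>; by quadratic reciprocity
  the equation \<open>n t\<^sup>2 = 2x\<^sup>2 + q r\<^sup>2\<close> then meets Legendre's solvability conditions. As \<open>q\<close> is rationally
  of the form \<open>u\<^sup>2 + 3v\<^sup>2\<close>, \<open>T\<close> represents \<open>n\<close> over the rationals, and the descent of Aubry, Davenport
  and Cassels makes the representation integral.

  The prime \<open>q\<close> only requires Dirichlet's theorem for real characters: by Mertens' argument
  \<open>\<Sum>\<^bsub>p \<le> N\<^esub> h(p) ln p / p\<close> stays bounded for a nonprincipal real character \<open>h\<close> since \<open>L(1,h) \<noteq> 0\<close>, while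
  for the principal one it diverges, and the product of \<open>1 + e\<^sub>i h\<^sub>i(p)\<close> singles out the wanted primes.
\<close>

section \<open>Chebyshev and Mertens estimates\<close>

text \<open>Both sides run over the pairs with \<open>d * m \<le> N\<close>, where
  \<open>n = d * m\<close>. This unfolds the Dirichlet convolutions behind \<open>ln\<close> and the
  Lambert series.\<close>

lemma sum_divisors_swap:
  fixes g :: "nat \<Rightarrow> nat \<Rightarrow> real"
  shows "(\<Sum>n=1..N. \<Sum>d | d dvd n. g d (n div d)) = (\<Sum>d=1..N. \<Sum>m=1..N div d. g d m)"
proof -
  have "(\<Sum>n=1..N. \<Sum>d | d dvd n. g d (n div d))
      = (\<Sum>(n,d)\<in>(SIGMA n:{1..N}. {d. d dvd n}). g d (n div d))"
    by (subst sum.Sigma) auto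
  also have "\<dots> = (\<Sum>(d,m)\<in>(SIGMA d:{1..N}. {1..N div d}). g d m)"
  proof (rule sum.reindex_bij_witness[where i = "\<lambda>(d,m). (d*m, d)" and j = "\<lambda>(n,d). (d, n div d)"], goal_cases)
    case (2 a)
    then obtain n d where a: "a = (n,d)" "n \<in> {1..N}" "d dvd n" by auto
    then show ?case
      by (auto simp: div_le_mono Suc_le_eq dvd_imp_le intro!: Nat.gr0I dest: dvd_imp_le)
  next
    case (4 b)
    then obtain d m where b: "b = (d,m)" "1 \<le> d" "1 \<le> m" "m \<le> N div d" by auto
    then have "d * m \<le> d * (N div d)" by simp
    also have "\<dots> \<le> N" by simp
    finally show ?case using b by auto
  qed auto
  also have "\<dots> = (\<Sum>d=1..N. \<Sum>m=1..N div d. g d m)"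
    by (subst sum.Sigma [symmetric]) auto
  finally show ?thesis .
qed

text \<open>Summation by parts. The bound is free of \<open>N\<close>, so it controls tails and
  limits alike.\<close>

lemma abs_weighted_sum_le:
  fixes a g :: "nat \<Rightarrow> real"
  assumes B: "\<And>j. \<bar>\<Sum>k=m..j. a k\<bar> \<le> B"
    and dec: "\<And>k. m \<le> k \<Longrightarrow> g (Suc k) \<le> g k"
    and pos: "\<And>k. m \<le> k \<Longrightarrow> 0 \<le> g k"
  shows "\<bar>\<Sum>k=m..N. a k * g k\<bar> \<le> B * g m"
proof (cases "m \<le> N")
  case False
  then show ?thesis using B[of m] pos[of m] by simp
next
  case True
  have B0: "0 \<le> B" using B[of m] by linarith
  define S where "S j = (\<Sum>k=m..j. a k)" for j
  \<comment> \<open>Removing the boundary term \<open>S N * g N\<close> makes the remaining error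
    telescope, so that the induction closes.\<close>
  have "\<bar>(\<Sum>k=m..N. a k * g k) - S N * g N\<bar> \<le> B * (g m - g N)"
    using True
  proof (induction N rule: dec_induct)
    case base
    then show ?case by (simp add: S_def)
  next
    case (step n)
    have "(\<Sum>k=m..Suc n. a k * g k) - S (Suc n) * g (Suc n)
        = ((\<Sum>k=m..n. a k * g k) - S n * g n) + S n * (g n - g (Suc n))"
      using step by (simp add: S_def algebra_simps)
    moreover have "\<bar>S n * (g n - g (Suc n))\<bar> \<le> B * (g n - g (Suc n))"
      using B[of n] dec[OF step(1)] by (simp add: S_def abs_mult mult_right_mono)
    ultimately show ?case using step.IH by (simp add: algebra_simps)
  qed
  moreover have "\<bar>S N * g N\<bar> \<le> B * g N"
    using B[of N] pos[OF True] by (simp add: S_def abs_mult mult_right_mono)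
  ultimately show ?thesis by (simp add: algebra_simps)
qed

text \<open>By coprimality a divisor of \<open>a * b\<close> is uniquely a divisor of
  \<open>a\<close> times one of \<open>b\<close>; its gcds with \<open>a\<close> and
  \<open>b\<close> recover the factors.\<close>

lemma sum_divisors_coprime_mult:
  fixes f :: "nat \<Rightarrow> real"
  assumes mult: "\<And>x y. f (x * y) = f x * f y" and "coprime a b" "a > 0" "b > 0"
  shows "(\<Sum>d | d dvd a * b. f d) = (\<Sum>d | d dvd a. f d) * (\<Sum>d | d dvd b. f d)"
proof -
  have gcds: "gcd (x * y) a = x" "gcd (x * y) b = y" if xy: "x dvd a" "y dvd b" for x y
  proof -
    have "coprime y a" "coprime x b"
      using xy assms(2) by (meson coprime_commute coprime_divisors dvd_refl)+
    then have "gcd (x * y) a = gcd x a" "gcd (x * y) b = gcd y b"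
      by (simp_all add: gcd_mult_left_right_cancel gcd_mult_left_left_cancel coprime_commute)
    then show "gcd (x * y) a = x" "gcd (x * y) b = y"
      using xy by (simp_all add: gcd_nat.absorb1)
  qed
  have "(\<Sum>d | d dvd a * b. f d) = (\<Sum>(x,y)\<in>{d. d dvd a} \<times> {d. d dvd b}. f x * f y)"
  proof (rule sum.reindex_bij_witness[where i = "\<lambda>(x,y). x * y" and j = "\<lambda>d. (gcd d a, gcd d b)"], goal_cases)
    case (1 d)
    then obtain x y where "d = x * y" "x dvd a" "y dvd b" using division_decomp by blast
    then show ?case using gcds[of x y] by simp
  next
    case (5 d)
    then obtain x y where "d = x * y" "x dvd a" "y dvd b" using division_decomp by blast
    then show ?case using gcds[of x y] mult[of x y] by simp
  qed (use gcds in \<open>auto intro: mult_dvd_mono\<close>)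
  then show ?thesis by (simp add: sum_product sum.cartesian_product)
qed

section \<open>Chebyshev's bound\<close>

definition psi :: "nat \<Rightarrow> real" where "psi N = (\<Sum>d=1..N. mangoldt d)"

lemma sum_ln_eq: "(\<Sum>n=1..N. ln (real n)) = (\<Sum>d=1..N. mangoldt d * real (N div d))"
proof -
  have "(\<Sum>n=1..N. ln (real n)) = (\<Sum>n=1..N. \<Sum>d | d dvd n. mangoldt d)"
    by (intro sum.cong) (auto simp: mangoldt_sum)
  also have "\<dots> = (\<Sum>d=1..N. mangoldt d * real (N div d))"
    by (subst sum_divisors_swap) (simp add: mult.commute)
  finally show ?thesis .
qed

lemma sum_ln_eq_ln_fact: "(\<Sum>n=1..N. ln (real n)) = ln (fact N)"
  by (induction N) (auto simp: ln_mult)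

text \<open>Chebyshev's argument: \<open>ln\<close> of the central binomial coefficient is at most
  \<open>n * ln 4\<close>. In it \<open>mangoldt d\<close> has weight \<open>w d\<close>, which is
  never negative and equals 1 for \<open>n < d \<le> 2 * n\<close>.\<close>

lemma psi_double_diff: "psi (2 * n) - psi n \<le> real n * ln 4"
proof -
  define w where "w d = real ((2 * n) div d) - 2 * real (n div d)" for d
  have T2: "ln (fact (2 * n)) = (\<Sum>d=1..2*n. mangoldt d * real ((2 * n) div d))"
    unfolding sum_ln_eq_ln_fact[symmetric] sum_ln_eq ..
  have "ln (fact n) = (\<Sum>d=1..n. mangoldt d * real (n div d))"
    unfolding sum_ln_eq_ln_fact[symmetric] sum_ln_eq ..
  also have "\<dots> = (\<Sum>d=1..2*n. mangoldt d * real (n div d))"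
    by (intro sum.mono_neutral_left) auto
  finally have T: "ln (fact (2 * n)) - 2 * ln (fact n) = (\<Sum>d=1..2*n. mangoldt d * w d)"
    unfolding T2 w_def by (simp add: sum_distrib_left sum_subtractf[symmetric] algebra_simps)
  have w0: "0 \<le> w d" for d
  proof -
    have "2 * (n div d) \<le> (2 * n) div d"
    proof (cases "d = 0")
      case False
      have "2 * (n div d) * d \<le> 2 * n" by simp
      then show ?thesis using False by (simp add: less_eq_div_iff_mult_less_eq)
    qed simp
    then have "real (2 * (n div d)) \<le> real ((2 * n) div d)" by (rule of_nat_mono)
    then show ?thesis by (simp add: w_def)
  qed
  have "psi (2 * n) - psi n = (\<Sum>d=Suc n..2*n. mangoldt d)"
    unfolding psi_def using sum.ub_add_nat[of 1 n "mangoldt :: nat \<Rightarrow> real" n] by (simp add: mult_2)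
  also have "\<dots> \<le> (\<Sum>d=Suc n..2*n. mangoldt d * w d)"
  proof (intro sum_mono)
    fix d assume d: "d \<in> {Suc n..2*n}"
    then have "(2 * n) div d = 1" by (intro div_nat_eqI) auto
    then show "mangoldt d \<le> (mangoldt d * w d :: real)" using d by (simp add: w_def)
  qed
  also have "\<dots> \<le> (\<Sum>d=1..2*n. mangoldt d * w d)"
    by (intro sum_mono2) (auto simp: w0 mangoldt_nonneg)
  also have "\<dots> = ln (real ((2 * n) choose n))"
  proof -
    have ln_quot: "ln (x / (y * y)) = ln x - 2 * ln y" if "x > 0" "y > 0" for x y :: real
      using that by (simp add: ln_div ln_mult)
    have "real ((2 * n) choose n) = fact (2 * n) / (fact n * fact n)"
      using binomial_fact[of n "2 * n", where ?'a = real] by simp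
    then show ?thesis unfolding T[symmetric] by (simp only: ln_quot fact_gt_zero)
  qed
  also have "\<dots> \<le> ln (4 ^ n)"
  proof -
    have "(2 * n) choose n \<le> 2 ^ (2 * n)" by (rule binomial_le_pow2)
    then have "real ((2 * n) choose n) \<le> real (2 ^ (2 * n))" by (rule of_nat_mono)
    then show ?thesis by (subst ln_le_cancel_iff) (auto simp: power_mult)
  qed
  finally show ?thesis by (simp add: ln_realpow)
qed

text \<open>At powers of two the doubling bounds sum to \<open>2 ^ k * ln 4\<close>; rounding
  \<open>N\<close> up to a power of two costs the factor 2.\<close>

lemma psi_le: "psi N \<le> 2 * ln 4 * real N"
proof (cases "N = 0")
  case False
  have pow: "psi (2 ^ k) \<le> 2 ^ k * ln 4" for k
  proof (induction k)
    case 0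
    show ?case by (simp add: psi_def)
  next
    case (Suc k)
    show ?case using psi_double_diff[of "2 ^ k"] Suc by simp
  qed
  define k where "k = floor_log N"
  have k: "2 ^ k \<le> N" "N \<le> 2 * 2 ^ k"
    using False floor_log_exp2_le[of N] floor_log_exp2_gt[of N] by (auto simp: k_def)
  have "psi N \<le> psi (2 ^ Suc k)"
    unfolding psi_def using k by (intro sum_mono2) (auto simp: mangoldt_nonneg)
  also have "\<dots> \<le> 2 ^ Suc k * ln 4" by (rule pow)
  also have "\<dots> \<le> 2 * real N * ln 4"
    using k(1) by (intro mult_right_mono) (simp_all add: numeral_power_le_of_nat_cancel_iff)
  finally show ?thesis by (simp only: mult_ac)
qed (simp add: psi_def)

section \<open>Mertens' lower bound and the contribution of higher prime powers\<close>

lemma ln_Suc_diff_le: "n > 0 \<Longrightarrow> real n * (ln (real (Suc n)) - ln (real n)) \<le> 1"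
proof -
  assume n: "n > 0"
  have eq: "1 + 1 / real n = real (Suc n) / real n" using n by (simp add: field_simps)
  have "ln (real (Suc n)) - ln (real n) = ln (1 + 1 / real n)"
    unfolding eq using n by (subst ln_div) auto
  also have "\<dots> \<le> 1 / real n" by (rule ln_add_one_self_le_self) simp
  finally show ?thesis using n by (simp add: field_simps)
qed

lemma ln_fact_ge: "real N * ln (real N) - real N \<le> ln (fact N)"
proof (induction N)
  case (Suc n)
  show ?case
  proof (cases "n = 0")
    case False
    have "ln (fact (Suc n)) = ln (real (Suc n)) + ln (fact n)" by (simp add: ln_mult del: of_nat_Suc)
    then show ?thesis using Suc ln_Suc_diff_le[of n] False by (simp add: algebra_simps)
  qed simp
qed simp

text \<open>In the expansion of \<open>ln (fact N)\<close>, replacing \<open>N div d\<close> by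
  \<open>N / d\<close> only increases the sum; a weak Stirling bound handles the other side.\<close>

lemma sum_mangoldt_div_ge:
  assumes "N > 0"
  shows "ln (real N) - 1 \<le> (\<Sum>d=1..N. mangoldt d / real d)"
proof -
  have "real N * (ln (real N) - 1) \<le> ln (fact N)" using ln_fact_ge[of N] by (simp add: algebra_simps)
  also have "\<dots> = (\<Sum>d=1..N. mangoldt d * real (N div d))"
    by (simp only: sum_ln_eq sum_ln_eq_ln_fact[symmetric])
  also have "\<dots> \<le> (\<Sum>d=1..N. mangoldt d * (real N / real d))"
    by (intro sum_mono mult_left_mono mangoldt_nonneg of_nat_div_le_of_nat)
  also have "\<dots> = real N * (\<Sum>d=1..N. mangoldt d / real d)"
    by (simp add: sum_distrib_left mult.commute)
  finally show ?thesis using assms by simp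
qed

text \<open>For each prime \<open>p\<close>, the powers with exponent at least 2 contribute at most
  \<open>2 * ln p / p ^ 2\<close>, which is dominated by the convergent series of
  \<open>4 * p powr (-3/2)\<close>.\<close>

lemma sum_mangoldt_nonprime_bounded:
  "\<exists>C. \<forall>N. (\<Sum>n | n \<in> {1..N} \<and> \<not> prime n. mangoldt n / real n) \<le> C"
proof (intro exI allI)
  fix N :: nat
  define g :: "nat \<Rightarrow> real" where "g n = mangoldt n / real n" for n
  have g0: "g n \<ge> 0" for n by (simp add: g_def mangoldt_nonneg)
  define I where "I = {p. prime p \<and> p \<le> N} \<times> {2..N}"
  have finI: "finite I" unfolding I_def by (intro finite_cartesian_product) auto
  have sub: "{n. n \<in> {1..N} \<and> \<not> prime n \<and> primepow n} \<subseteq> (\<lambda>(p,k). p ^ k) ` I"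
  proof
    fix n assume n: "n \<in> {n. n \<in> {1..N} \<and> \<not> prime n \<and> primepow n}"
    then obtain p k where pk: "prime p" "k > 0" "n = p ^ k" by (auto simp: primepow_def)
    have "k \<noteq> 1" using n pk by auto
    moreover have "k \<le> n" unfolding pk(3)
      using self_le_ge2_pow[of p k] prime_ge_2_nat[OF pk(1)] by simp
    moreover have "p \<le> n" unfolding pk(3) using pk(1,2) by (simp add: dvd_imp_le prime_gt_0_nat)
    ultimately have "(p, k) \<in> I" using n pk by (auto simp: I_def)
    then show "n \<in> (\<lambda>(p,k). p ^ k) ` I" using pk by force
  qed
  have inner: "(\<Sum>k=2..N. 1 / real p ^ k) \<le> 2 / real p ^ 2" if "p \<ge> 2" for p
  proof -
    \<comment> \<open>The subtracted term \<open>1 / p ^ n\<close> is the slack that lets the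
      induction close.\<close>
    have "(\<Sum>k=2..n. 1 / real p ^ k) \<le> 2 / real p ^ 2 - 1 / real p ^ n" if "n \<ge> 2" for n
      using that
    proof (induction n rule: dec_induct)
      case (step n)
      have "2 / real p ^ Suc n \<le> 1 / real p ^ n" using \<open>p \<ge> 2\<close> by (simp add: field_simps)
      then show ?case using step by simp
    qed simp
    then have "(\<Sum>k=2..N. 1 / real p ^ k) \<le> 2 / real p ^ 2 - 1 / real p ^ N" if "N \<ge> 2"
      using that .
    moreover have "0 \<le> 1 / real p ^ N" by simp
    ultimately show ?thesis by (cases "N \<ge> 2") (linarith, simp)
  qed
  have ln_le: "ln (real p) * (2 / real p ^ 2) \<le> 4 * real p powr (-3/2)" if "p \<ge> 2" for p
  proof -
    have p0: "real p > 0" using that by simp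
    \<comment> \<open>Passing to the root trades \<open>ln p\<close> for \<open>2 * sqrt p\<close>,
      which leaves the summable exponent -3/2.\<close>
    have "ln (real p) = 2 * ln (sqrt (real p))" using p0 by (simp add: ln_sqrt)
    also have "\<dots> \<le> 2 * sqrt (real p)" using ln_le_minus_one[of "sqrt (real p)"] p0 by simp
    finally have "ln (real p) * (2 / real p ^ 2) \<le> 2 * sqrt (real p) * (2 / real p ^ 2)"
      by (intro mult_right_mono) auto
    also have "\<dots> = 4 * (real p powr (1/2) * real p powr (-2))"
      using p0 by (simp add: powr_half_sqrt powr_minus powr_numeral field_simps)
    also have "\<dots> = 4 * real p powr (-3/2)" by (simp add: powr_add[symmetric])
    finally show ?thesis .
  qed
  have "(\<Sum>n | n \<in> {1..N} \<and> \<not> prime n. g n) = (\<Sum>n | n \<in> {1..N} \<and> \<not> prime n \<and> primepow n. g n)"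
    by (intro sum.mono_neutral_right) (auto simp: g_def mangoldt_def)
  also have "\<dots> \<le> sum g ((\<lambda>(p,k). p ^ k) ` I)"
    using finI sub g0 by (intro sum_mono2) auto
  also have "\<dots> \<le> sum (g \<circ> (\<lambda>(p,k). p ^ k)) I"
    using finI g0 by (intro sum_image_le) auto
  also have "\<dots> = (\<Sum>p | prime p \<and> p \<le> N. \<Sum>k=2..N. ln (real p) * (1 / real p ^ k))"
    unfolding I_def sum.cartesian_product by (intro sum.cong) (auto simp: g_def)
  also have "\<dots> \<le> (\<Sum>p | prime p \<and> p \<le> N. 4 * real p powr (-3/2))"
  proof (intro sum_mono)
    fix p assume "p \<in> {p. prime p \<and> p \<le> N}"
    then have p2: "p \<ge> 2" by (simp add: prime_ge_2_nat)
    have "(\<Sum>k=2..N. ln (real p) * (1 / real p ^ k)) = ln (real p) * (\<Sum>k=2..N. 1 / real p ^ k)"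
      by (simp only: sum_distrib_left)
    also have "\<dots> \<le> ln (real p) * (2 / real p ^ 2)"
      using p2 by (intro mult_left_mono inner) auto
    also have "\<dots> \<le> 4 * real p powr (-3/2)" by (rule ln_le[OF p2])
    finally show "(\<Sum>k=2..N. ln (real p) * (1 / real p ^ k)) \<le> 4 * real p powr (-3/2)" .
  qed
  also have "\<dots> = 4 * (\<Sum>p | prime p \<and> p \<le> N. real p powr (-3/2))"
    by (simp only: sum_distrib_left)
  also have "\<dots> \<le> 4 * (\<Sum>p. real p powr (-3/2))"
    by (intro mult_left_mono sum_le_suminf) (auto simp: summable_real_powr_iff)
  finally show "(\<Sum>n | n \<in> {1..N} \<and> \<not> prime n. mangoldt n / real n) \<le> 4 * (\<Sum>p. real p powr (-3/2))"
    by (simp only: g_def)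
qed

section \<open>Real characters\<close>

text \<open>A real character with period \<open>M\<close>. Being nonprincipal enters as a vanishing
  sum over one period, the form in which it bounds all partial sums.\<close>

locale nonprincipal_real_character =
  fixes h :: "nat \<Rightarrow> real" and M :: nat
  assumes M_pos: "M > 0"
    and mult: "h (m * n) = h m * h n"
    and one: "h 1 = 1"
    and vals: "h n \<in> {-1, 0, 1}"
    and periodic: "h (n + M) = h n"
    and sum_period: "(\<Sum>n<M. h n) = 0"
begin

section \<open>Convergence of the series for \<open>L(1, h)\<close>\<close>

lemma abs_le_1: "\<bar>h n\<bar> \<le> 1"
  using vals[of n] by auto

lemma abs_initial_sum_le: "\<bar>\<Sum>k<n. h k\<bar> \<le> real M"
proof (induction n rule: less_induct)
  case (less n)
  show ?case
  proof (cases "n < M")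
    case True
    have "\<bar>\<Sum>k<n. h k\<bar> \<le> (\<Sum>k<n. 1)"
      by (rule order_trans[OF sum_abs]) (intro sum_mono abs_le_1)
    then show ?thesis using True by simp
  next
    case False
    then obtain j where j: "n = j + M" by (metis add.commute le_Suc_ex not_less)
    have "(\<Sum>k<j + M. h k) = (\<Sum>k<M. h k) + (\<Sum>k=0+M..<j+M. h k)"
      by (simp add: lessThan_atLeast0 sum.atLeastLessThan_concat del: sum.lessThan_Suc)
    also have "\<dots> = (\<Sum>k<j. h k)"
      unfolding sum.shift_bounds_nat_ivl using sum_period by (simp add: periodic lessThan_atLeast0)
    finally show ?thesis using less[of j] j M_pos by simp
  qed
qed

text \<open>An interval sum is a difference of two initial sums, each at most \<open>M\<close> in
  absolute value; hence the factor 2.\<close>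

definition "B = 2 * real M"

lemma abs_interval_sum_le: "\<bar>\<Sum>k=m..j. h k\<bar> \<le> B"
proof (cases "m \<le> Suc j")
  case True
  have "(\<Sum>k<m. h k) + (\<Sum>k=m..j. h k) = (\<Sum>k<Suc j. h k)"
    using True sum.atLeastLessThan_concat[of 0 m "Suc j" h]
    by (simp add: lessThan_atLeast0 atLeastLessThanSuc_atLeastAtMost)
  then show ?thesis
    using abs_initial_sum_le[of m] abs_initial_sum_le[of "Suc j"] by (simp add: B_def)
qed (simp add: B_def)

lemma B_pos: "B > 0" using M_pos by (simp add: B_def)

definition partial_L where "partial_L n = (\<Sum>k=1..n. h k / real k)"

lemma abs_partial_L_diff_le:
  assumes "m \<le> n"
  shows "\<bar>partial_L n - partial_L m\<bar> \<le> B / real (Suc m)"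
proof -
  have "partial_L n - partial_L m = (\<Sum>k=Suc m..n. h k * (1 / real k))"
    using sum.ub_add_nat[of 1 m "\<lambda>k. h k / real k" "n - m"] assms by (simp add: partial_L_def)
  also have "\<bar>\<dots>\<bar> \<le> B * (1 / real (Suc m))"
    by (rule abs_weighted_sum_le) (auto simp: abs_interval_sum_le frac_le)
  finally show ?thesis by simp
qed

text \<open>The value \<open>L(1, h)\<close>; that the limit exists is
  \<open>partial_L_tendsto\<close>.\<close>

definition "L = lim partial_L"

lemma partial_L_tendsto: "partial_L \<longlonglongrightarrow> L"
proof -
  have "Cauchy partial_L"
  proof (rule CauchyI')
    fix e :: real assume "e > 0"
    obtain m0 :: nat where m0: "real m0 > B / e" using reals_Archimedean2 by blast
    have "dist (partial_L m) (partial_L n) < e" if "m0 \<le> m" "m < n" for m n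
    proof -
      have "real m0 < real (Suc m)" using that by simp
      then have "B / e < real (Suc m)" using m0 by linarith
      then have "B / real (Suc m) < e" using \<open>e > 0\<close> by (simp add: field_simps)
      then show ?thesis using abs_partial_L_diff_le[of m n] that by (simp add: dist_real_def abs_minus_commute)
    qed
    then show "\<exists>m0. \<forall>m\<ge>m0. \<forall>n>m. dist (partial_L m) (partial_L n) < e" by blast
  qed
  then show ?thesis
    unfolding L_def by (simp add: Cauchy_convergent convergent_LIMSEQ_iff[symmetric])
qed

lemma abs_partial_L_minus_L_le: "\<bar>partial_L m - L\<bar> \<le> B / real (Suc m)"
proof -
  have "(\<lambda>n. \<bar>partial_L n - partial_L m\<bar>) \<longlonglongrightarrow> \<bar>L - partial_L m\<bar>"
    by (intro tendsto_intros partial_L_tendsto)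
  then have "\<bar>L - partial_L m\<bar> \<le> B / real (Suc m)"
    by (rule LIMSEQ_le_const2) (use abs_partial_L_diff_le in blast)
  then show ?thesis by (simp add: abs_minus_commute)
qed

section \<open>Divisor sums of the character\<close>

text \<open>The divisors are powers of \<open>p\<close>, so this is a finite geometric series in
  \<open>h p\<close>, which is -1, 0 or 1; in the case 0 the term \<open>i = 0\<close> still
  contributes 1.\<close>

lemma sum_prime_power_divisors:
  assumes "prime p"
  shows "(\<Sum>d | d dvd p ^ k. h d) \<ge> 0" "even k \<Longrightarrow> (\<Sum>d | d dvd p ^ k. h d) \<ge> 1"
proof -
  have "{d. d dvd p ^ k} = (\<lambda>i. p ^ i) ` {..k}"
    using divides_primepow_nat[OF assms] by auto
  moreover have "inj_on (\<lambda>i. p ^ i) {..k}"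
    using assms prime_gt_1_nat[OF assms] by (auto simp: inj_on_def)
  moreover have pow: "h (p ^ i) = h p ^ i" for i
    using one by (induction i) (auto simp: mult)
  ultimately have eq: "(\<Sum>d | d dvd p ^ k. h d) = (\<Sum>i\<le>k. h p ^ i)"
    by (simp add: sum.reindex)
  consider "h p = -1" | "h p = 0" | "h p = 1" using vals[of p] by auto
  then have "(\<Sum>i\<le>k. h p ^ i) \<ge> 0 \<and> (even k \<longrightarrow> (\<Sum>i\<le>k. h p ^ i) \<ge> 1)"
  proof cases
    case 1
    have "(\<Sum>i\<le>k. (-1::real) ^ i) = (if even k then 1 else 0)"
      by (induction k) auto
    with 1 show ?thesis by simp
  next
    case 2
    have "(\<Sum>i\<le>k. (0::real) ^ i) = 1"
      by (induction k) auto
    with 2 show ?thesis by simp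
  next
    case 3
    then show ?thesis by simp
  qed
  then show "(\<Sum>d | d dvd p ^ k. h d) \<ge> 0" "even k \<Longrightarrow> (\<Sum>d | d dvd p ^ k. h d) \<ge> 1"
    by (simp_all add: eq)
qed

text \<open>The coefficients of the Lambert series of \<open>h\<close>.\<close>

definition divisor_sum where "divisor_sum n = (\<Sum>d | d dvd n. h d)"

text \<open>Multiplicativity reduces both bounds to prime powers. Squares are described by even
  multiplicities because this condition passes to the cofactor \<open>m\<close> in the
  induction.\<close>

lemma divisor_sum_bounds:
  assumes "n > 0"
  shows "divisor_sum n \<ge> 0 \<and> ((\<forall>p. prime p \<longrightarrow> even (multiplicity p n)) \<longrightarrow> divisor_sum n \<ge> 1)"
  using assms
proof (induction n rule: less_induct)
  case (less n)
  show ?case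
  proof (cases "n = 1")
    case True
    then show ?thesis using one by (simp add: divisor_sum_def)
  next
    case False
    then obtain p where p: "prime p" "p dvd n" using prime_factor_nat by blast
    define k where "k = multiplicity p n"
    obtain m where m: "n = p ^ k * m" "\<not> p dvd m"
      unfolding k_def using multiplicity_decompose'[of n p] less.prems p
      by (metis not_prime_unit neq0_conv)
    have k0: "k > 0" unfolding k_def using p less.prems
      by (simp add: prime_multiplicity_gt_zero_iff)
    have m0: "m > 0" using m less.prems by (auto intro: Nat.gr0I)
    have "p ^ k > 1" using k0 prime_gt_1_nat[OF p(1)] by (rule_tac one_less_power)
    then have mn: "m < n" using m m0 by simp
    have cop: "coprime (p ^ k) m" using p m by (simp add: prime_imp_coprime)
    have fn: "divisor_sum n = (\<Sum>d | d dvd p ^ k. h d) * divisor_sum m"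
      unfolding divisor_sum_def m(1) using m0 p
      by (intro sum_divisors_coprime_mult[where f = h, OF mult cop]) (auto simp: prime_gt_0_nat)
    have "multiplicity q m = (if q = p then 0 else multiplicity q n)" if "prime q" for q
    proof (cases "q = p")
      case True
      then show ?thesis using m(2) by (simp add: not_dvd_imp_multiplicity_0)
    next
      case False
      have "multiplicity q n = multiplicity q (p ^ k) + multiplicity q m"
        unfolding m(1) using that m0 p by (intro prime_elem_multiplicity_mult_distrib) auto
      also have "multiplicity q (p ^ k) = 0"
        using that p False by (metis not_dvd_imp_multiplicity_0 prime_dvd_power primes_dvd_imp_eq)
      finally show ?thesis using False by simp
    qed
    then have ev: "(\<forall>p. prime p \<longrightarrow> even (multiplicity p n)) \<Longrightarrow> (\<forall>q. prime q \<longrightarrow> even (multiplicity q m)) \<and> even k"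
      using p by (auto simp: k_def)
    have IH: "divisor_sum m \<ge> 0" "(\<forall>q. prime q \<longrightarrow> even (multiplicity q m)) \<Longrightarrow> divisor_sum m \<ge> 1"
      using less.IH[OF mn m0] by blast+
    show ?thesis
    proof (intro conjI impI)
      show "0 \<le> divisor_sum n"
        unfolding fn by (intro mult_nonneg_nonneg sum_prime_power_divisors IH p)
      assume "\<forall>p. prime p \<longrightarrow> even (multiplicity p n)"
      then have "1 * 1 \<le> (\<Sum>d | d dvd p ^ k. h d) * divisor_sum m"
        using ev by (intro mult_mono sum_prime_power_divisors IH p) auto
      then show "1 \<le> divisor_sum n" by (simp add: fn)
    qed
  qed
qed

lemma divisor_sum_nonneg: "n > 0 \<Longrightarrow> divisor_sum n \<ge> 0"
  using divisor_sum_bounds by blast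

lemma divisor_sum_square:
  assumes "k > 0"
  shows "divisor_sum (k ^ 2) \<ge> 1"
proof -
  have "even (multiplicity p (k ^ 2))" if "prime p" for p
    using that assms by (simp add: prime_elem_multiplicity_power_distrib)
  then show ?thesis using divisor_sum_bounds[of "k ^ 2"] assms by simp
qed

end

context nonprincipal_real_character begin

context
  fixes r :: real
  assumes r: "0 < r" "r < 1"
begin

text \<open>Monsky's proof that \<open>L(1,h) \<noteq> 0\<close>: if \<open>L = 0\<close>, the Lambert series of \<open>h\<close> at \<open>r\<close> equals minus the
  sum of \<open>h n * gap n\<close>, where \<open>gap n = 1/(n(1 - r)) - r\<^sup>n/(1 - r\<^sup>n)\<close> decreases from 1 to 0, and so is
  bounded uniformly in \<open>r\<close>; but its coefficients are nonnegative and at least 1 on squares.\<close>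

definition geom where "geom n = (\<Sum>i<n. r ^ i)"

lemma geom_Suc: "geom (Suc n) = 1 + r * geom n"
  unfolding geom_def by (subst sum.lessThan_Suc_shift) (simp add: sum_distrib_left)

lemma geometric: "1 - r ^ n = (1 - r) * geom n"
  unfolding geom_def using one_diff_power_eq[of r n] by simp

text \<open>AM-GM on the pairs \<open>r ^ i\<close> and \<open>r ^ (n - 1 - i)\<close>, whose
  geometric mean is \<open>sqrt r ^ (n - 1)\<close>.\<close>

lemma geom_ge:
  assumes "n > 0"
  shows "real n * sqrt r ^ (n - 1) \<le> geom n"
proof -
  define t where "t = sqrt r"
  have t: "r = t ^ 2" using r by (simp add: t_def)
  have "2 * geom n = (\<Sum>i<n. r ^ i) + (\<Sum>i<n. r ^ (n - Suc i))"
    by (simp only: geom_def sum.nat_diff_reindex mult_2)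
  also have "\<dots> = (\<Sum>i<n. r ^ i + r ^ (n - Suc i))" by (simp add: sum.distrib)
  also have "\<dots> \<ge> (\<Sum>i<n. 2 * t ^ (n - 1))"
  proof (intro sum_mono)
    fix i assume "i \<in> {..<n}"
    then have "t ^ i * t ^ (n - Suc i) = t ^ (n - 1)" by (simp add: power_add[symmetric])
    moreover have "0 \<le> (t ^ i - t ^ (n - Suc i)) ^ 2" by simp
    moreover have "r ^ j = (t ^ j)\<^sup>2" for j by (simp only: t power_mult[symmetric] mult.commute)
    ultimately show "2 * t ^ (n - 1) \<le> r ^ i + r ^ (n - Suc i)"
      by (simp only: power2_diff mult.assoc)
  qed
  finally show ?thesis by (simp add: t_def)
qed

lemma geom_pos: "n > 0 \<Longrightarrow> geom n > 0"
  unfolding geom_def using r by (intro sum_pos) auto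

text \<open>The AM-GM bounds for \<open>n\<close> and \<open>n + 1\<close> multiply to the exponent
  \<open>2 * n - 1\<close> of \<open>sqrt r\<close>; raising it to \<open>2 * n\<close> gives
  \<open>r ^ n\<close>.\<close>

lemma geom_mult_ge:
  assumes "n > 0"
  shows "real n * real (Suc n) * r ^ n \<le> geom n * geom (Suc n)"
proof -
  define t where "t = sqrt r"
  have t: "r = t ^ 2" "0 < t" "t < 1" using r by (simp_all add: t_def)
  have "r ^ n = t ^ (2 * n)" by (simp add: t power_mult)
  also have "\<dots> \<le> t ^ ((n - 1) + n)" using t assms by (intro power_decreasing) auto
  also have "\<dots> = t ^ (n - 1) * t ^ n" by (rule power_add)
  finally have "real n * real (Suc n) * r ^ n \<le> real n * real (Suc n) * (t ^ (n - 1) * t ^ n)"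
    by (intro mult_left_mono) auto
  also have "\<dots> = (real n * t ^ (n - 1)) * (real (Suc n) * t ^ n)" by (simp only: mult_ac)
  also have "\<dots> \<le> geom n * geom (Suc n)"
  proof (rule mult_mono)
    show "real n * t ^ (n - 1) \<le> geom n" unfolding t_def by (rule geom_ge[OF assms])
    show "real (Suc n) * t ^ n \<le> geom (Suc n)" using geom_ge[of "Suc n"] unfolding t_def by simp
    show "0 \<le> geom n" using geom_pos[OF assms] by simp
    show "0 \<le> real (Suc n) * t ^ n" using t(2) by simp
  qed
  finally show ?thesis .
qed

definition gap where "gap n = (1 / real n - r ^ n / geom n) / (1 - r)"

lemma gap_eq:
  assumes "n > 0"
  shows "gap n = 1 / (real n * (1 - r)) - r ^ n / (1 - r ^ n)"
  using r geom_pos[OF assms] assms unfolding gap_def geometric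
  by (simp add: diff_divide_distrib mult_ac)

lemma gap_1: "gap 1 = 1"
  using r by (simp add: gap_def geom_def)

text \<open>Since \<open>geom (Suc n) - r * geom n = 1\<close>, the subtracted part of
  \<open>gap\<close> falls by \<open>r ^ n / (geom n * geom (Suc n))\<close>, at most the fall
  \<open>1 / (n * (n + 1))\<close> of \<open>1 / n\<close>.\<close>

lemma gap_Suc_le:
  assumes "n > 0"
  shows "gap (Suc n) \<le> gap n"
proof -
  note sp = geom_pos[OF assms] geom_pos[of "Suc n"]
  have "r ^ n / geom n - r ^ Suc n / geom (Suc n) = r ^ n * (geom (Suc n) - r * geom n) / (geom n * geom (Suc n))"
    using sp by (simp add: field_simps)
  also have "\<dots> = r ^ n / (geom n * geom (Suc n))" by (simp add: geom_Suc)
  also have "\<dots> \<le> 1 / (real n * real (Suc n))"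
    using geom_mult_ge[OF assms] sp assms r
    by (subst frac_le_eq) (auto simp: divide_le_0_iff mult_ac simp del: of_nat_Suc intro!: mult_nonneg_nonneg)
  also have "\<dots> = 1 / real n - 1 / real (Suc n)" using assms by (simp add: field_simps)
  finally have "1 / real (Suc n) - r ^ Suc n / geom (Suc n) \<le> 1 / real n - r ^ n / geom n" by linarith
  then show ?thesis unfolding gap_def using r by (intro divide_right_mono) auto
qed

lemma gap_nonneg:
  assumes "n > 0"
  shows "0 \<le> gap n"
proof -
  have "real n * r ^ n = (\<Sum>i<n. r ^ n)" by simp
  also have "\<dots> \<le> geom n" unfolding geom_def using r by (intro sum_mono power_decreasing) auto
  finally have "r ^ n / geom n \<le> 1 / real n" using geom_pos[OF assms] assms by (simp add: field_simps)
  then show ?thesis unfolding gap_def using r by simp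
qed

text \<open>Summation by parts with first weight \<open>gap 1 = 1\<close>, so the bound does not
  involve \<open>r\<close>.\<close>

lemma abs_sum_gap_le: "\<bar>\<Sum>d=1..N. h d * gap d\<bar> \<le> B"
  using abs_weighted_sum_le[where m = 1 and a = h and B = B and g = gap and N = N] abs_interval_sum_le gap_Suc_le gap_nonneg
  by (simp add: gap_1[simplified])

text \<open>After the swap the inner sums are geometric. Their main part
  \<open>r ^ d / (1 - r ^ d)\<close> splits by \<open>gap_eq\<close> into the
  \<open>partial_L\<close> and \<open>gap\<close> terms; the truncation at \<open>N\<close> accounts
  for the last summand.\<close>

lemma lambert_partial_sum_le:
  "(\<Sum>n=1..N. divisor_sum n * r ^ n) \<le> \<bar>partial_L N\<bar> / (1 - r) + B + real N * r ^ N / (1 - r)"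
proof -
  have "(\<Sum>n=1..N. divisor_sum n * r ^ n) = (\<Sum>n=1..N. \<Sum>d | d dvd n. h d * r ^ (d * (n div d)))"
    unfolding divisor_sum_def sum_distrib_right by (intro sum.cong) auto
  also have "\<dots> = (\<Sum>d=1..N. \<Sum>m=1..N div d. h d * r ^ (d * m))"
    by (rule sum_divisors_swap)
  also have "\<dots> = (\<Sum>d=1..N. h d / real d * (1 / (1 - r)) - h d * gap d
      - h d * (r ^ (d * (N div d + 1)) / (1 - r ^ d)))"
  proof (intro sum.cong refl)
    fix d assume d: "d \<in> {1..N}"
    then have rd: "r ^ d < 1" using r by (simp add: power_Suc_less_one power_less_one_iff)
    have "(\<Sum>m=1..K. r ^ (d * m)) * (1 - r ^ d) = r ^ d - r ^ (d * (K + 1))" for K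
    proof (induction K)
      case (Suc K)
      have "(\<Sum>m=1..Suc K. r ^ (d * m)) * (1 - r ^ d)
          = (\<Sum>m=1..K. r ^ (d * m)) * (1 - r ^ d) + r ^ (d * Suc K) * (1 - r ^ d)"
        by (simp add: distrib_right)
      also have "\<dots> = r ^ d - r ^ (d * (K + 1)) + (r ^ (d * Suc K) - r ^ (d * Suc K) * r ^ d)"
        unfolding Suc by (simp add: right_diff_distrib)
      also have "\<dots> = r ^ d - r ^ (d * (Suc K + 1))"
        by (simp add: power_add mult.commute)
      finally show ?case .
    qed simp
    then have "(\<Sum>m=1..K. r ^ (d * m)) = r ^ d / (1 - r ^ d) - r ^ (d * (K + 1)) / (1 - r ^ d)" for K
      using rd by (simp add: eq_divide_eq diff_divide_distrib[symmetric])
    then have "(\<Sum>m=1..N div d. h d * r ^ (d * m))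
        = h d * (r ^ d / (1 - r ^ d) - r ^ (d * (N div d + 1)) / (1 - r ^ d))"
      by (simp only: sum_distrib_left[symmetric])
    then show "(\<Sum>m=1..N div d. h d * r ^ (d * m)) = h d / real d * (1 / (1 - r)) - h d * gap d
      - h d * (r ^ (d * (N div d + 1)) / (1 - r ^ d))"
      using d by (simp add: gap_eq algebra_simps)
  qed
  also have "\<dots> = partial_L N * (1 / (1 - r)) - (\<Sum>d=1..N. h d * gap d)
      - (\<Sum>d=1..N. h d * (r ^ (d * (N div d + 1)) / (1 - r ^ d)))"
    unfolding partial_L_def by (simp only: sum_subtractf sum_distrib_right)
  also have "\<dots> \<le> \<bar>partial_L N\<bar> / (1 - r) + B + real N * r ^ N / (1 - r)"
  proof -
    have "partial_L N * (1 / (1 - r)) \<le> \<bar>partial_L N\<bar> / (1 - r)" using r by (simp add: divide_right_mono)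
    moreover have "\<bar>\<Sum>d=1..N. h d * (r ^ (d * (N div d + 1)) / (1 - r ^ d))\<bar> \<le> (\<Sum>d=1..N. r ^ N / (1 - r))"
    proof (rule order_trans[OF sum_abs], intro sum_mono)
      fix d assume d: "d \<in> {1..N}"
      then have rd: "r ^ d \<le> r" using r power_decreasing[of 1 d r] by simp
      \<comment> \<open>\<open>d * (N div d + 1)\<close> is the first multiple of \<open>d\<close>
        beyond \<open>N\<close>.\<close>
      have "N < d * (N div d + 1)"
        using d by (metis Suc_eq_plus1 add.commute atLeastAtMost_iff dividend_less_times_div less_le_trans mult_Suc_right zero_less_one)
      then have "r ^ (d * (N div d + 1)) \<le> r ^ N" using r by (intro power_decreasing) auto
      then have "r ^ (d * (N div d + 1)) / (1 - r ^ d) \<le> r ^ N / (1 - r)"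
        using r rd by (intro frac_le) auto
      moreover have "0 \<le> r ^ (d * (N div d + 1)) / (1 - r ^ d)" using r rd by simp
      ultimately have "\<bar>h d\<bar> * (r ^ (d * (N div d + 1)) / (1 - r ^ d)) \<le> 1 * (r ^ N / (1 - r))"
        using abs_le_1[of d] by (intro mult_mono) auto
      then show "\<bar>h d * (r ^ (d * (N div d + 1)) / (1 - r ^ d))\<bar> \<le> r ^ N / (1 - r)"
        using r rd by (simp add: abs_mult)
    qed
    ultimately show ?thesis using abs_sum_gap_le[of N] by simp
  qed
  finally show ?thesis .
qed

text \<open>Only square indices are kept, each with coefficient at least 1; then \<open>N\<close>
  tends to infinity with \<open>r\<close> fixed, and \<open>L = 0\<close> removes the
  \<open>partial_L\<close> term.\<close>

lemma sum_powers_squares_le: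
  assumes "L = 0"
  shows "(\<Sum>k=1..K. r ^ (k ^ 2)) \<le> B"
proof (rule LIMSEQ_le_const)
  have "(\<lambda>N. \<bar>partial_L N\<bar> / (1 - r) + B + real N * r ^ N / (1 - r)) \<longlonglongrightarrow> \<bar>0\<bar> / (1 - r) + B + 0 / (1 - r)"
    using r partial_L_tendsto assms by (intro tendsto_intros powser_times_n_limit_0) auto
  then show "(\<lambda>N. \<bar>partial_L N\<bar> / (1 - r) + B + real N * r ^ N / (1 - r)) \<longlonglongrightarrow> B" by simp
  have "(\<Sum>k=1..K. r ^ (k ^ 2)) \<le> \<bar>partial_L N\<bar> / (1 - r) + B + real N * r ^ N / (1 - r)" if N: "N \<ge> K ^ 2" for N
  proof -
    have "(\<Sum>k=1..K. r ^ (k ^ 2)) \<le> (\<Sum>k=1..K. divisor_sum (k ^ 2) * r ^ (k ^ 2))"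
      using divisor_sum_square r by (intro sum_mono) (simp add: mult_le_cancel_right1)
    also have "\<dots> = (\<Sum>n\<in>(\<lambda>k. k ^ 2) ` {1..K}. divisor_sum n * r ^ n)"
      by (subst sum.reindex) (auto simp: inj_on_def)
    also have "\<dots> \<le> (\<Sum>n=1..N. divisor_sum n * r ^ n)"
    proof (intro sum_mono2)
      show "(\<lambda>k. k ^ 2) ` {1..K} \<subseteq> {1..N}"
        using N by (auto intro: order_trans[OF power_mono])
    qed (use divisor_sum_nonneg r in auto)
    also note lambert_partial_sum_le
    finally show ?thesis .
  qed
  then show "\<exists>N0. \<forall>N\<ge>N0. (\<Sum>k=1..K. r ^ (k ^ 2)) \<le> \<bar>partial_L N\<bar> / (1 - r) + B + real N * r ^ N / (1 - r)"
    by blast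
qed

end

text \<open>If \<open>L = 0\<close>, letting \<open>r\<close> tend to 1 from below with
  \<open>K\<close> fixed gives \<open>K \<le> B\<close> for every \<open>K\<close>.\<close>

lemma L_nonzero: "L \<noteq> 0"
proof
  assume L: "L = 0"
  have "real K \<le> B" for K
  proof (rule tendsto_upperbound)
    show "((\<lambda>r. \<Sum>k=1..K. r ^ (k ^ 2)) \<longlongrightarrow> real K) (at_left (1::real))"
    proof -
      have "((\<lambda>r::real. \<Sum>k=1..K. r ^ (k ^ 2)) \<longlongrightarrow> (\<Sum>k=1..K. 1 ^ (k ^ 2))) (at_left 1)"
        by (intro tendsto_intros)
      then show ?thesis by simp
    qed
    show "\<forall>\<^sub>F r in at_left (1::real). (\<Sum>k=1..K. r ^ (k ^ 2)) \<le> B"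
      using eventually_at_left_real[OF zero_less_one] by eventually_elim (use sum_powers_squares_le L in auto)
  qed simp
  moreover obtain K :: nat where "real K > B" using reals_Archimedean2 by blast
  ultimately show False by (meson not_less)
qed

section \<open>Mertens' bounds weighted by the character\<close>

text \<open>\<open>ln x / x\<close> decreases from Euler's number on, hence the threshold 3: there
  \<open>k * (ln (k + 1) - ln k) \<le> 1 \<le> ln k\<close>.\<close>

lemma ln_div_decreasing:
  assumes "3 \<le> k"
  shows "ln (real (Suc k)) / real (Suc k) \<le> ln (real k) / real k"
proof -
  have "(1::real) \<le> ln 3" using exp_le by (subst ln_ge_iff) auto
  also have "\<dots> \<le> ln (real k)" using assms by simp
  finally have "real k * (ln (real (Suc k)) - ln (real k)) \<le> ln (real k)"
    using ln_Suc_diff_le[of k] assms by linarith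
  then have "real k * ln (real (Suc k)) \<le> real (Suc k) * ln (real k)"
    unfolding of_nat_Suc[of k] by (simp only: algebra_simps)
  then show ?thesis using assms by (simp add: field_simps del: of_nat_Suc)
qed

lemma sum_h_ln_bounded: "\<exists>C. \<forall>N. \<bar>\<Sum>n=1..N. h n * (ln (real n) / real n)\<bar> \<le> C"
proof (intro exI allI)
  fix N
  define g where "g n = h n * (ln (real n) / real n)" for n
  have tail: "\<bar>\<Sum>n=3..N. g n\<bar> \<le> B * (ln 3 / 3)"
    unfolding g_def
    using abs_weighted_sum_le[where m = 3 and a = h and B = B and g = "\<lambda>n. ln (real n) / real n" and N = N] abs_interval_sum_le ln_div_decreasing
    by simp
  show "\<bar>\<Sum>n=1..N. h n * (ln (real n) / real n)\<bar> \<le> \<bar>g 1\<bar> + \<bar>g 2\<bar> + B * (ln 3 / 3)"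
  proof (cases "N \<ge> 3")
    case True
    have "(\<Sum>n=1..N. g n) = g 1 + g 2 + (\<Sum>n=3..N. g n)"
      using True by (simp add: sum.atLeast_Suc_atMost numeral_eq_Suc)
    then show ?thesis unfolding g_def[symmetric] using tail by linarith
  next
    case False
    then consider "N = 0" | "N = 1" | "N = 2" by linarith
    then have "\<bar>\<Sum>n=1..N. g n\<bar> \<le> \<bar>g 1\<bar> + \<bar>g 2\<bar>"
      by cases (auto simp: numeral_2_eq_2)
    moreover have "0 \<le> B * (ln 3 / 3)" using B_pos by simp
    ultimately show ?thesis unfolding g_def[symmetric] by linarith
  qed
qed

text \<open>Writing \<open>ln\<close> as a divisor sum of \<open>mangoldt\<close> turns the bounded
  sum of \<open>h n * ln n / n\<close> into \<open>L\<close> times the wanted sum plus an error. The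
  error is at most \<open>psi N * (B / N)\<close>, bounded by Chebyshev, and
  \<open>L \<noteq> 0\<close> permits division.\<close>

lemma sum_h_mangoldt_bounded: "\<exists>C. \<forall>N. \<bar>\<Sum>d=1..N. h d * (mangoldt d / real d)\<bar> \<le> C"
proof -
  obtain C where C: "\<And>N. \<bar>\<Sum>n=1..N. h n * (ln (real n) / real n)\<bar> \<le> C"
    using sum_h_ln_bounded by blast
  have "\<bar>\<Sum>d=1..N. h d * (mangoldt d / real d)\<bar> \<le> (C + B * (2 * ln 4)) / \<bar>L\<bar>" for N
  proof -
    define g where "g d = h d * (mangoldt d / real d)" for d
    have "(\<Sum>n=1..N. h n * (ln (real n) / real n))
        = (\<Sum>n=1..N. \<Sum>d | d dvd n. g d * (h (n div d) / real (n div d)))"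
    proof (intro sum.cong refl)
      fix n assume n: "n \<in> {1..N}"
      have "h n * (ln (real n) / real n) = h n / real n * (\<Sum>d | d dvd n. mangoldt d)"
        using n by (simp add: mangoldt_sum)
      also have "\<dots> = (\<Sum>d | d dvd n. h n / real n * mangoldt d)"
        by (rule sum_distrib_left)
      also have "\<dots> = (\<Sum>d | d dvd n. g d * (h (n div d) / real (n div d)))"
      proof (intro sum.cong refl)
        fix d assume "d \<in> {d. d dvd n}"
        then obtain m where m: "n = d * m" by auto
        then have "d > 0" "m > 0" using n by auto
        then show "h n / real n * mangoldt d = g d * (h (n div d) / real (n div d))"
          by (simp add: m mult g_def)
      qed
      finally show "h n * (ln (real n) / real n) = (\<Sum>d | d dvd n. g d * (h (n div d) / real (n div d)))" .
    qed
    also have "\<dots> = (\<Sum>d=1..N. \<Sum>m=1..N div d. g d * (h m / real m))" by (rule sum_divisors_swap)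
    also have "\<dots> = (\<Sum>d=1..N. g d * partial_L (N div d))" by (simp only: partial_L_def sum_distrib_left)
    also have "\<dots> = L * (\<Sum>d=1..N. g d) + (\<Sum>d=1..N. g d * (partial_L (N div d) - L))"
      by (simp add: sum_distrib_left sum.distrib[symmetric] algebra_simps)
    finally have main: "(\<Sum>n=1..N. h n * (ln (real n) / real n))
        = L * (\<Sum>d=1..N. g d) + (\<Sum>d=1..N. g d * (partial_L (N div d) - L))" .
    have "\<bar>\<Sum>d=1..N. g d * (partial_L (N div d) - L)\<bar> \<le> (\<Sum>d=1..N. mangoldt d * (B / real N))"
    proof (rule order_trans[OF sum_abs], intro sum_mono)
      fix d assume d: "d \<in> {1..N}"
      have "real N / real d \<le> real (Suc (N div d))"
        proof -
        have "N < Suc (N div d) * d" using d by (simp add: dividend_less_div_times)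
        then have "real N < real (Suc (N div d)) * real d" by (metis of_nat_less_iff of_nat_mult)
        then show ?thesis using d by (simp add: divide_le_eq)
      qed
      then have "B / real (Suc (N div d)) \<le> B / (real N / real d)"
        using d B_pos by (intro divide_left_mono) auto
      then have "\<bar>partial_L (N div d) - L\<bar> \<le> B * real d / real N"
        using abs_partial_L_minus_L_le[of "N div d"] by simp
      moreover have "\<bar>g d\<bar> \<le> mangoldt d / real d"
        unfolding g_def abs_mult using mult_right_mono[OF abs_le_1[of d], of "mangoldt d / real d"]
        by (simp add: mangoldt_nonneg)
      ultimately have "\<bar>g d\<bar> * \<bar>partial_L (N div d) - L\<bar> \<le> (mangoldt d / real d) * (B * real d / real N)"
        by (intro mult_mono) (auto simp: mangoldt_nonneg)
      also have "\<dots> = mangoldt d * (B / real N)" using d by simp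
      finally show "\<bar>g d * (partial_L (N div d) - L)\<bar> \<le> mangoldt d * (B / real N)" by (simp add: abs_mult)
    qed
    also have "\<dots> = psi N * (B / real N)" by (simp only: psi_def sum_distrib_right)
    also have "\<dots> \<le> (2 * ln 4 * real N) * (B / real N)"
      using B_pos by (intro mult_right_mono psi_le) auto
    also have "\<dots> \<le> B * (2 * ln 4)" using B_pos by (cases "N = 0") auto
    finally have "\<bar>L * (\<Sum>d=1..N. g d)\<bar> \<le> C + B * (2 * ln 4)"
      using main C[of N] by linarith
    then show ?thesis using L_nonzero by (simp add: abs_mult g_def field_simps)
  qed
  then show ?thesis by blast
qed

end

section \<open>Primes with prescribed values of real characters\<close>

lemma sum_split_prime:
  fixes g :: "nat \<Rightarrow> real"
  shows "(\<Sum>n=1..N. g n * (mangoldt n / real n)) =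
    (\<Sum>p | p \<in> {1..N} \<and> prime p. g p * (ln (real p) / real p)) +
    (\<Sum>n | n \<in> {1..N} \<and> \<not> prime n. g n * (mangoldt n / real n))"
proof -
  have "(\<Sum>n=1..N. g n * (mangoldt n / real n)) =
    (\<Sum>p | p \<in> {1..N} \<and> prime p. g p * (mangoldt p / real p)) +
    (\<Sum>n | n \<in> {1..N} \<and> \<not> prime n. g n * (mangoldt n / real n))"
    by (subst sum.union_disjoint[symmetric]) (auto intro!: sum.cong)
  then show ?thesis by simp
qed

lemma sum_primes_ge: "\<exists>C. \<forall>N>0. ln (real N) - C \<le> (\<Sum>p | p \<in> {1..N} \<and> prime p. ln (real p) / real p)"
proof -
  obtain C where C: "\<And>N. (\<Sum>n | n \<in> {1..N} \<and> \<not> prime n. mangoldt n / real n) \<le> C"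
    using sum_mangoldt_nonprime_bounded by blast
  have "ln (real N) - (C + 1) \<le> (\<Sum>p | p \<in> {1..N} \<and> prime p. ln (real p) / real p)" if "N > 0" for N
    using sum_mangoldt_div_ge[OF that] sum_split_prime[of "\<lambda>_. 1" N] C[of N] by simp
  then show ?thesis by blast
qed

lemma (in nonprincipal_real_character) sum_primes_bounded:
  "\<exists>C. \<forall>N. \<bar>\<Sum>p | p \<in> {1..N} \<and> prime p. h p * (ln (real p) / real p)\<bar> \<le> C"
proof -
  obtain C where C: "\<And>N. (\<Sum>n | n \<in> {1..N} \<and> \<not> prime n. mangoldt n / real n) \<le> C"
    using sum_mangoldt_nonprime_bounded by blast
  obtain C' where C': "\<And>N. \<bar>\<Sum>d=1..N. h d * (mangoldt d / real d)\<bar> \<le> C'"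
    using sum_h_mangoldt_bounded by blast
  have "\<bar>\<Sum>p | p \<in> {1..N} \<and> prime p. h p * (ln (real p) / real p)\<bar> \<le> C + C'" for N
  proof -
    have "\<bar>\<Sum>n | n \<in> {1..N} \<and> \<not> prime n. h n * (mangoldt n / real n)\<bar>
        \<le> (\<Sum>n | n \<in> {1..N} \<and> \<not> prime n. mangoldt n / real n)"
    proof (rule order_trans[OF sum_abs], intro sum_mono)
      fix n
      show "\<bar>h n * (mangoldt n / real n)\<bar> \<le> mangoldt n / real n"
        unfolding abs_mult using mult_right_mono[OF abs_le_1[of n], of "mangoldt n / real n"]
        by (simp add: mangoldt_nonneg)
    qed
    then show ?thesis using C[of N] C'[of N] sum_split_prime[of h N] by linarith
  qed
  then show ?thesis by blast
qed

text \<open>Multiplication by \<open>a\<close> permutes the residues modulo \<open>M\<close> and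
  flips the sign of \<open>h\<close>, so the sum equals its negative.\<close>

lemma sum_period_eq_0:
  fixes h :: "nat \<Rightarrow> real"
  assumes mult: "\<And>m n. h (m * n) = h m * h n" and per: "\<And>n. h (n + M) = h n"
    and a: "coprime a M" "h a = -1" and "M > 0"
  shows "(\<Sum>n<M. h n) = 0"
proof -
  have "h (n + k * M) = h n" for n k
    by (induction k) (use per in \<open>auto simp: add.assoc[symmetric] add.commute[of M]\<close>)
  then have h_mod: "h (n mod M) = h n" for n
    by (metis add.commute div_mult_mod_eq)
  have inj: "inj_on (\<lambda>n. a * n mod M) {..<M}"
  proof (rule inj_onI)
    fix x y assume xy: "x \<in> {..<M}" "y \<in> {..<M}" "a * x mod M = a * y mod M"
    then have "[a * x = a * y] (mod M)" unfolding cong_def by blast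
    then have "[x = y] (mod M)" using a(1) by (simp add: cong_mult_lcancel_nat)
    then show "x = y" using xy by (simp add: cong_def)
  qed
  have "(\<lambda>n. a * n mod M) ` {..<M} = {..<M}"
    using inj assms(5) by (intro endo_inj_surj) auto
  then have "(\<Sum>n<M. h n) = (\<Sum>n<M. h (a * n mod M))"
    using sum.reindex[OF inj, of h] by simp
  also have "\<dots> = - (\<Sum>n<M. h n)"
    by (simp add: h_mod mult a(2) sum_negf)
  finally show ?thesis by simp
qed

text \<open>\<open>indep\<close> provides, for each index, a residue at which only that character is
  -1; hence every product over a nonempty subset of \<open>I\<close> is nonprincipal. When
  \<open>w\<close> is expanded over subsets, only the empty one gives an unbounded sum.\<close>

theorem prime_with_character_values:
  fixes X :: "'i \<Rightarrow> nat \<Rightarrow> real" and e :: "'i \<Rightarrow> real"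
  assumes fin: "finite I" and M: "M > 0"
    and mult: "\<And>i m n. i \<in> I \<Longrightarrow> X i (m * n) = X i m * X i n"
    and one: "\<And>i. i \<in> I \<Longrightarrow> X i 1 = 1"
    and vals: "\<And>i n. i \<in> I \<Longrightarrow> X i n \<in> {-1, 0, 1}"
    and per: "\<And>i n. i \<in> I \<Longrightarrow> X i (n + M) = X i n"
    and nz: "\<And>i n. i \<in> I \<Longrightarrow> coprime n M \<Longrightarrow> X i n \<noteq> 0"
    and indep: "\<And>i. i \<in> I \<Longrightarrow> \<exists>a. coprime a M \<and> X i a = -1 \<and> (\<forall>j\<in>I - {i}. X j a = 1)"
    and e: "\<And>i. i \<in> I \<Longrightarrow> e i \<in> {-1, 1}"
  shows "\<exists>p>K. prime p \<and> (\<forall>i\<in>I. X i p = e i)"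
proof (rule ccontr)
  assume contra: "\<not> (\<exists>p>K. prime p \<and> (\<forall>i\<in>I. X i p = e i))"
  define Q where "Q h N = (\<Sum>p | p \<in> {1..N} \<and> prime p. h p * (ln (real p) / real p))"
    for h :: "nat \<Rightarrow> real" and N
  define H where "H S n = (\<Prod>i\<in>S. X i n)" for S n
  have bounded: "\<exists>C. \<forall>N. \<bar>Q (H S) N\<bar> \<le> C" if S: "S \<in> Pow I - {{}}" for S
  proof -
    obtain i where i: "i \<in> S" "i \<in> I" using S by blast
    have finS: "finite S" using S fin finite_subset by auto
    obtain a where a: "coprime a M" "X i a = -1" "\<forall>j\<in>I - {i}. X j a = 1"
      using indep[OF i(2)] by blast
    have Hmult: "H S (m * n) = H S m * H S n" for m n
      unfolding H_def prod.distrib[symmetric] using S by (intro prod.cong) (auto simp: mult)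
    have Hper: "H S (n + M) = H S n" for n
      unfolding H_def using S by (intro prod.cong) (auto simp: per)
    have "H S a = X i a * (\<Prod>j\<in>S - {i}. X j a)"
      unfolding H_def using finS i by (simp add: prod.remove)
    also have "(\<Prod>j\<in>S - {i}. X j a) = 1" using a S by (intro prod.neutral) auto
    finally have Ha: "H S a = -1" using a by simp
    interpret nonprincipal_real_character "H S" M
    proof
      show "H S 1 = 1" unfolding H_def using S one by (intro prod.neutral) auto
      show "H S n \<in> {-1, 0, 1}" for n
        unfolding H_def using finS S
      proof (induction S rule: finite_induct)
        case (insert x T)
        then have "X x n \<in> {-1, 0, 1}" "x \<in> I" using vals by auto
        moreover have "(\<Prod>i\<in>T. X i n) \<in> {-1, 0, 1}"
          using insert by (cases "T = {}") auto
        ultimately show ?case using insert by auto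
      qed simp
      show "(\<Sum>n<M. H S n) = 0" by (rule sum_period_eq_0[OF Hmult Hper a(1) Ha M])
    qed (use M Hmult Hper in auto)
    show ?thesis unfolding Q_def by (rule sum_primes_bounded)
  qed
  then obtain C where C: "\<And>S N. S \<in> Pow I - {{}} \<Longrightarrow> \<bar>Q (H S) N\<bar> \<le> C S"
    by metis
  obtain C0 where C0: "\<And>N. N > 0 \<Longrightarrow> ln (real N) - C0 \<le> Q (\<lambda>_. 1) N"
    unfolding Q_def using sum_primes_ge by auto
  define w where "w n = (\<Prod>i\<in>I. e i * X i n + 1)" for n
  have abs_e: "\<bar>\<Prod>i\<in>S. e i\<bar> = 1" if "S \<subseteq> I" for S
    unfolding abs_prod
  proof (intro prod.neutral ballI)
    fix i assume "i \<in> S"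
    then have "i \<in> I" using that by blast
    then show "\<bar>e i\<bar> = 1" using e[of i] by auto
  qed
  have expand: "Q w N = (\<Sum>S\<in>Pow I. (\<Prod>i\<in>S. e i) * Q (H S) N)" for N
  proof -
    have "w n = (\<Sum>S\<in>Pow I. (\<Prod>i\<in>S. e i) * H S n)" for n
      unfolding w_def H_def by (subst prod_add[OF fin]) (simp add: prod.distrib)
    then have "Q w N = (\<Sum>p | p \<in> {1..N} \<and> prime p. \<Sum>S\<in>Pow I. (\<Prod>i\<in>S. e i) * (H S p * (ln (real p) / real p)))"
      unfolding Q_def by (simp only: sum_distrib_right mult.assoc)
    also have "\<dots> = (\<Sum>S\<in>Pow I. (\<Prod>i\<in>S. e i) * Q (H S) N)"
      unfolding Q_def sum_distrib_left by (rule sum.swap)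
    finally show ?thesis .
  qed
  have lower: "ln (real N) - C0 - sum C (Pow I - {{}}) \<le> Q w N" if "N > 0" for N
  proof -
    have "Q w N = Q (H {}) N + (\<Sum>S\<in>Pow I - {{}}. (\<Prod>i\<in>S. e i) * Q (H S) N)"
      unfolding expand using fin by (subst sum.remove[of _ "{}"]) auto
    moreover have "H {} = (\<lambda>_. 1)" by (simp add: H_def fun_eq_iff)
    moreover have "\<bar>\<Sum>S\<in>Pow I - {{}}. (\<Prod>i\<in>S. e i) * Q (H S) N\<bar> \<le> sum C (Pow I - {{}})"
    proof (rule order_trans[OF sum_abs], intro sum_mono)
      fix S assume S: "S \<in> Pow I - {{}}"
      then show "\<bar>(\<Prod>i\<in>S. e i) * Q (H S) N\<bar> \<le> C S"
        unfolding abs_mult using C[OF S, of N] abs_e[of S] by simp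
    qed
    ultimately show ?thesis using C0[OF that] by simp
  qed
  \<comment> \<open>A prime above \<open>M\<close> is coprime to \<open>M\<close>, so a value
    \<open>X i p\<close> other than \<open>e i\<close> must be \<open>- e i\<close>, and that factor
    of \<open>w p\<close> vanishes.\<close>
  define K' where "K' = max K M"
  have w0: "w p = 0" if p: "prime p" "p > K'" for p
  proof -
    obtain i where i: "i \<in> I" "X i p \<noteq> e i" using contra p by (auto simp: K'_def)
    have "\<not> p dvd M" using p M by (auto simp: K'_def dest: dvd_imp_le)
    then have "coprime p M" using p by (simp add: prime_imp_coprime)
    then have "e i * X i p + 1 = 0" using i nz[of i p] vals[of i p] e[of i] by auto
    then show ?thesis unfolding w_def using i fin by (intro prod_zero) auto
  qed
  have upper: "Q w N = Q w K'" if "N \<ge> K'" for N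
    unfolding Q_def using that w0
    by (intro sum.mono_neutral_right) (auto simp: not_le[symmetric])
  obtain N :: nat where N: "real N > exp (Q w K' + C0 + sum C (Pow I - {{}}))"
    using reals_Archimedean2 by blast
  define N' where "N' = max N K'"
  have "0 < real N" using N by (meson exp_gt_zero less_trans)
  then have N': "N' > 0" "N' \<ge> N" "N' \<ge> K'" by (auto simp: N'_def)
  have "Q w K' + C0 + sum C (Pow I - {{}}) < ln (real N')"
    using N N' by (subst exp_less_cancel_iff[symmetric]) (auto intro: less_le_trans)
  then show False using lower[OF N'(1)] upper[OF N'(3)] by simp
qed

section \<open>Legendre symbols\<close>

lemma Legendre_vals: "Legendre a p \<in> {-1, 0, 1}"
  by (simp add: Legendre_def)

lemma Legendre_eq_0_iff: "Legendre a p = 0 \<longleftrightarrow> p dvd a"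
  by (simp add: Legendre_def cong_0_iff)

lemma Legendre_eq_1D: "Legendre a p = 1 \<Longrightarrow> \<exists>y. p dvd y\<^sup>2 - a"
  by (auto simp: Legendre_def QuadRes_def cong_iff_dvd_diff split: if_splits)

lemma Legendre_cong: "[a = b] (mod p) \<Longrightarrow> Legendre a p = Legendre b p"
  by (simp add: Legendre_def QuadRes_def cong_def)

text \<open>Such values differ by at most 2, less than \<open>p\<close>; this upgrades Euler's
  criterion to equations between symbols.\<close>

lemma small_cong_imp_eq:
  fixes x y p :: int
  assumes "[x = y] (mod p)" "x \<in> {-1, 0, 1}" "y \<in> {-1, 0, 1}" "2 < p"
  shows "x = y"
proof (rule ccontr)
  assume "x \<noteq> y"
  then have "\<bar>p\<bar> \<le> \<bar>x - y\<bar>" using assms(1) by (intro dvd_imp_le_int) (auto simp: cong_iff_dvd_diff)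
  then show False using assms by auto
qed

lemma Legendre_mult:
  assumes "prime p" "2 < p"
  shows "Legendre (a * b) (int p) = Legendre a (int p) * Legendre b (int p)"
proof (rule small_cong_imp_eq)
  show "[Legendre (a * b) (int p) = Legendre a (int p) * Legendre b (int p)] (mod int p)"
    using euler_criterion[OF assms, of "a * b"] cong_mult[OF euler_criterion[OF assms, of a] euler_criterion[OF assms, of b]]
    unfolding power_mult_distrib by (metis cong_sym cong_trans)
  show "Legendre a (int p) * Legendre b (int p) \<in> {-1, 0, 1}"
    using Legendre_vals[of a p] Legendre_vals[of b p] by auto
qed (use assms Legendre_vals in auto)

lemma Legendre_1: "1 < p \<Longrightarrow> Legendre 1 p = 1"
  by (auto simp: Legendre_def QuadRes_def cong_0_iff intro: exI[of _ 1])

lemma Legendre_prod: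
  assumes "prime p" "2 < p" "finite S"
  shows "Legendre (\<Prod>x\<in>S. f x) (int p) = (\<Prod>x\<in>S. Legendre (f x) (int p))"
  using assms(3) by (induction S rule: finite_induct) (use assms in \<open>auto simp: Legendre_mult Legendre_1\<close>)

section \<open>The characters modulo 4 and 8 and the supplementary laws\<close>

text \<open>At an odd prime \<open>n\<close> this is the Legendre symbol of -1, and
  \<open>chi8\<close> below is that of 2.\<close>

definition chi4 :: "nat \<Rightarrow> int" where
  "chi4 n = (if n mod 4 = 1 then 1 else if n mod 4 = 3 then -1 else 0)"

definition chi8 :: "nat \<Rightarrow> int" where
  "chi8 n = (if n mod 8 \<in> {1, 7} then 1 else if n mod 8 \<in> {3, 5} then -1 else 0)"

lemma chi4_mod: "chi4 (n mod 4) = chi4 n"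
  by (simp add: chi4_def)

lemma chi8_mod: "chi8 (n mod 8) = chi8 n"
  by (simp add: chi8_def)

lemma chi4_mult: "chi4 (m * n) = chi4 m * chi4 n"
proof -
  have "chi4 (a * b) = chi4 a * chi4 b" if "a < 4" "b < 4" for a b
  proof -
    have "a = 0 \<or> a = 1 \<or> a = 2 \<or> a = 3" "b = 0 \<or> b = 1 \<or> b = 2 \<or> b = 3"
      using that by linarith+
    then show ?thesis by (elim disjE; simp add: chi4_def)
  qed
  then have "chi4 (m mod 4 * (n mod 4)) = chi4 (m mod 4) * chi4 (n mod 4)" by simp
  also have "chi4 (m mod 4 * (n mod 4)) = chi4 (m * n)"
    by (subst (1 2) chi4_mod[symmetric]) (simp only: mod_mult_eq)
  finally show ?thesis by (simp only: chi4_mod)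
qed

lemma chi8_mult: "chi8 (m * n) = chi8 m * chi8 n"
proof -
  have "chi8 (a * b) = chi8 a * chi8 b" if "a < 8" "b < 8" for a b
  proof -
    have "a = 0 \<or> a = 1 \<or> a = 2 \<or> a = 3 \<or> a = 4 \<or> a = 5 \<or> a = 6 \<or> a = 7"
      "b = 0 \<or> b = 1 \<or> b = 2 \<or> b = 3 \<or> b = 4 \<or> b = 5 \<or> b = 6 \<or> b = 7"
      using that by linarith+
    then show ?thesis by (elim disjE; simp add: chi8_def)
  qed
  then have "chi8 (m mod 8 * (n mod 8)) = chi8 (m mod 8) * chi8 (n mod 8)" by simp
  also have "chi8 (m mod 8 * (n mod 8)) = chi8 (m * n)"
    by (subst (1 2) chi8_mod[symmetric]) (simp only: mod_mult_eq)
  finally show ?thesis by (simp only: chi8_mod)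
qed

lemma chi4_prod: "finite S \<Longrightarrow> chi4 (\<Prod>x\<in>S. f x) = (\<Prod>x\<in>S. chi4 (f x))"
  by (induction S rule: finite_induct) (simp_all add: chi4_mult chi4_def[of "Suc 0"])

lemma chi8_prod: "finite S \<Longrightarrow> chi8 (\<Prod>x\<in>S. f x) = (\<Prod>x\<in>S. chi8 (f x))"
  by (induction S rule: finite_induct) (simp_all add: chi8_mult chi8_def[of "Suc 0"])

lemma minus_one_power_half:
  assumes "odd p"
  shows "(-1) ^ ((p - 1) div 2) = chi4 p"
proof -
  have "p mod 4 = 1 \<or> p mod 4 = 3" using assms by presburger
  then show ?thesis
  proof
    assume "p mod 4 = 1"
    then have "even ((p - 1) div 2)" by presburger
    then show ?thesis using \<open>p mod 4 = 1\<close> by (simp add: chi4_def)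
  next
    assume "p mod 4 = 3"
    then have "odd ((p - 1) div 2)" by presburger
    then show ?thesis using \<open>p mod 4 = 3\<close> by (simp add: chi4_def)
  qed
qed

lemma Legendre_minus_1:
  assumes "prime p" "2 < p"
  shows "Legendre (-1) (int p) = chi4 p"
proof (rule small_cong_imp_eq)
  have "odd p" using assms by (simp add: prime_odd_nat)
  then show "[Legendre (-1) (int p) = chi4 p] (mod int p)"
    using euler_criterion[OF assms, of "-1"] unfolding minus_one_power_half[OF \<open>odd p\<close>] by blast
qed (use assms Legendre_vals in \<open>auto simp: chi4_def\<close>)

text \<open>Gauss's lemma for the multiplier 2: the doubles exceeding \<open>m = (p - 1) / 2\<close>
  come from the \<open>x\<close> in \<open>{m div 2<..m}\<close>, and the parity of their number is
  determined by \<open>p mod 8\<close>.\<close>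

lemma Legendre_2:
  assumes "prime p" "2 < p"
  shows "Legendre 2 (int p) = chi8 p"
proof -
  interpret GAUSS p 2
    using assms by unfold_locales (auto simp: cong_0_iff zdvd_not_zless)
  define m where "m = (int p - 1) div 2"
  have "odd p" using assms by (simp add: prime_odd_nat)
  have "E = (\<lambda>x. 2 * x) ` {m div 2<..m}"
  proof -
    have "C = (\<lambda>x. 2 * x) ` A"
      unfolding C_def B_def image_image using p_eq2
      by (intro image_cong refl) (auto simp: A_def)
    then show ?thesis unfolding E_def A_def m_def[symmetric] using assms
      by (auto simp: image_iff m_def)
  qed
  then have "card E = nat (m - m div 2)"
    by (simp add: card_image inj_on_def)
  then have L: "Legendre 2 (int p) = (-1) ^ nat (m - m div 2)"
    using gauss_lemma by simp
  define k where "k = p div 8"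
  have "p mod 8 \<in> {1,3,5,7}" using \<open>odd p\<close> by auto presburger
  moreover have p: "int p = 8 * int k + int (p mod 8)"
    unfolding k_def by (metis mult_div_mod_eq of_nat_add of_nat_mult of_nat_numeral)
  ultimately consider "p mod 8 = 1" "nat (m - m div 2) = 2 * k"
    | "p mod 8 = 3" "nat (m - m div 2) = 2 * k + 1"
    | "p mod 8 = 5" "nat (m - m div 2) = 2 * k + 1"
    | "p mod 8 = 7" "nat (m - m div 2) = 2 * k + 2"
    unfolding m_def by auto
  then show ?thesis by cases (simp_all add: L chi8_def)
qed

text \<open>Squaring modulo \<open>p\<close> sends both 1 and \<open>p - 1\<close> to 1, so it is
  not injective, hence not onto; a missed value is a nonresidue, nonzero because 0 is a
  square.\<close>

lemma ex_nonresidue: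
  assumes "prime p" "2 < p"
  shows "\<exists>a::nat. Legendre (int a) (int p) = -1"
proof -
  define sq where "sq x = x\<^sup>2 mod p" for x :: nat
  have "sq 1 = sq (p - 1)"
  proof -
    obtain k where "p = k + 2" using assms by (metis add.commute le_Suc_ex less_imp_le)
    moreover have "(k + 1)\<^sup>2 = 1 + k * (k + 2)" by (simp add: power2_eq_square)
    then have "(k + 1)\<^sup>2 mod (k + 2) = 1 mod (k + 2)" by (simp only: mod_mult_self1)
    ultimately show ?thesis by (simp add: sq_def)
  qed
  then have "\<not> inj_on sq {..<p}"
    using assms inj_onD[of sq "{..<p}" 1 "p - 1"] by auto
  moreover have "sq ` {..<p} \<subseteq> {..<p}" using assms by (auto simp: sq_def)
  ultimately have "sq ` {..<p} \<noteq> {..<p}" by (metis eq_card_imp_inj_on finite_lessThan)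
  then obtain y where y: "y < p" "y \<notin> sq ` {..<p}"
    using \<open>sq ` {..<p} \<subseteq> {..<p}\<close> by blast
  have "\<not> QuadRes (int p) (int y)"
  proof
    assume "QuadRes (int p) (int y)"
    then obtain z where z: "z\<^sup>2 mod int p = int y mod int p" by (auto simp: QuadRes_def cong_def)
    define x where "x = nat (z mod int p)"
    have x: "int x = z mod int p" "x < p" using assms by (auto simp: x_def nat_less_iff)
    have "int (sq x) = (z mod int p)\<^sup>2 mod int p" by (simp add: sq_def zmod_int x)
    also have "\<dots> = int y" using z y by (simp add: power_mod)
    finally show False using y x by auto
  qed
  moreover have "\<not> int p dvd int y"
  proof -
    have "sq 0 \<in> sq ` {..<p}" using assms by (intro imageI) simp
    moreover have "sq 0 = 0" by (simp add: sq_def)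
    ultimately have "y > 0" using y(2) by (metis gr0I)
    then have "\<not> p dvd y" using y(1) by (rule nat_dvd_not_less)
    then show ?thesis by simp
  qed
  ultimately have "Legendre (int y) (int p) = -1" by (simp add: Legendre_def cong_0_iff)
  then show ?thesis by blast
qed

section \<open>Primes with prescribed residue modulo 8 and Legendre symbols\<close>

lemma ex_root_mod_prod:
  fixes P :: "nat set"
  assumes "finite P" "\<And>p. p \<in> P \<Longrightarrow> prime p" "\<And>p. p \<in> P \<Longrightarrow> Legendre a (int p) = 1"
  shows "\<exists>k. int (\<Prod>P) dvd k\<^sup>2 - a"
  using assms
proof (induction P rule: finite_induct)
  case (insert p P)
  then obtain k where k: "int (\<Prod>P) dvd k\<^sup>2 - a" by auto
  obtain y where y: "int p dvd y\<^sup>2 - a" using insert Legendre_eq_1D by blast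
  have "coprime p (\<Prod>P)" using insert by (intro prod_coprime_right) (auto intro: primes_coprime)
  then have cop: "coprime (int p) (int (\<Prod>P))" by (simp only: coprime_int_iff)
  then obtain x where x: "[x = y] (mod int p)" "[x = k] (mod int (\<Prod>P))"
    using binary_chinese_remainder_int by blast
  have "[x\<^sup>2 = a] (mod int p)" "[x\<^sup>2 = a] (mod int (\<Prod>P))"
    using x y k by (meson cong_iff_dvd_diff cong_pow cong_trans)+
  then have "int p * int (\<Prod>P) dvd x\<^sup>2 - a"
    using cop by (intro divides_mult) (auto simp: cong_iff_dvd_diff)
  then show ?case using insert by auto
qed auto

text \<open>\<open>chi4\<close> and \<open>chi8\<close> together separate the odd classes modulo 8,
  so a residue condition becomes two character values.\<close>

lemma mod_8_eq_if_chi_eq: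
  assumes "chi4 q = chi4 r" "chi8 q = chi8 r" "r \<in> {1, 3, 5, 7}"
  shows "q mod 8 = r"
proof -
  define s where "s = q mod 8"
  have "s mod 4 = q mod 4" by (simp add: s_def mod_mod_cancel)
  then have "chi4 s = chi4 q" by (simp add: chi4_def)
  then have "chi4 s = chi4 r" using assms(1) by simp
  moreover have "chi8 s = chi8 r" using assms(2) by (simp add: s_def chi8_mod)
  moreover have "s < 8" by (simp add: s_def)
  then have "s \<in> {0, 1, 2, 3, 4, 5, 6, 7}" by auto
  ultimately have "s = r"
    using assms(3) by (elim insertE emptyE; simp add: chi4_def chi8_def)
  then show ?thesis by (simp add: s_def)
qed

text \<open>Applies \<open>prime_with_character_values\<close> to \<open>chi4\<close>,
  \<open>chi8\<close> and the symbols at \<open>P\<close>, all of period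
  \<open>8 * \<Prod>P\<close>. Independence comes from the Chinese remainder theorem.\<close>

theorem ex_prime_with_Legendre:
  fixes P :: "nat set" and e :: "nat \<Rightarrow> int"
  assumes fin: "finite P" and P: "\<And>p. p \<in> P \<Longrightarrow> prime p \<and> 2 < p"
    and e: "\<And>p. p \<in> P \<Longrightarrow> e p \<in> {-1, 1}" and r: "r \<in> {1, 3, 5, 7}"
  shows "\<exists>q>K. prime q \<and> q mod 8 = r \<and> (\<forall>p\<in>P. Legendre (int q) (int p) = e p)"
proof -
  \<comment> \<open>The indices 4 and 8 will tag \<open>chi4\<close> and \<open>chi8\<close>; as
    nonprimes they cannot clash with elements of \<open>P\<close>.\<close>
  have no: "4 \<notin> P" "8 \<notin> P"
    using P[of 4] P[of 8] by (auto simp: prime_nat_iff dest!: spec[of _ 2])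
  define X where "X i n = (if i = 4 then chi4 n else if i = 8 then chi8 n else Legendre (int n) (int i))" for i n :: nat
  define e' where "e' i = (if i = 4 then chi4 r else if i = 8 then chi8 r else e i)" for i :: nat
  define I where "I = insert 4 (insert 8 P)"
  define M where "M = 8 * \<Prod>P"
  have XP: "X p = (\<lambda>n. Legendre (int n) (int p))" if "p \<in> P" for p
    using that no by (auto simp: X_def)
  have X4: "X 4 = chi4" and X8: "X 8 = chi8" by (auto simp: X_def)
  have I_cases: "i \<in> I \<Longrightarrow> (i = 4 \<Longrightarrow> thesis) \<Longrightarrow> (i = 8 \<Longrightarrow> thesis) \<Longrightarrow> (i \<in> P \<Longrightarrow> thesis) \<Longrightarrow> thesis" for i thesis
    by (auto simp: I_def)
  have dvdM: "p dvd M" if "p \<in> P" for p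
    unfolding M_def using that fin by (intro dvd_mult dvd_prodI)
  have "\<exists>q>K. prime q \<and> (\<forall>i\<in>I. real_of_int (X i q) = real_of_int (e' i))"
  proof (rule prime_with_character_values[where M = M and X = "\<lambda>i n. real_of_int (X i n)" and e = "\<lambda>i. real_of_int (e' i)"])
    show "finite I" using fin by (simp add: I_def)
    show "M > 0" using P fin by (auto simp: M_def prime_gt_0_nat intro!: prod_pos)
  next
    fix i m n assume "i \<in> I"
    then have "X i (m * n) = X i m * X i n"
      by (rule I_cases) (use P in \<open>auto simp: X4 X8 XP chi4_mult chi8_mult Legendre_mult\<close>)
    then show "real_of_int (X i (m * n)) = real_of_int (X i m) * real_of_int (X i n)" by simp
  next
    fix i assume "i \<in> I"
    then have "X i 1 = 1"
      by (rule I_cases) (use P[of i] in \<open>auto simp: X4 X8 XP chi4_def chi8_def Legendre_1\<close>)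
    then show "real_of_int (X i 1) = 1" by simp
  next
    fix i n assume "i \<in> I"
    then have "X i n \<in> {-1, 0, 1}"
      by (rule I_cases) (use Legendre_vals in \<open>auto simp: X4 X8 XP chi4_def chi8_def\<close>)
    then show "real_of_int (X i n) \<in> {-1, 0, 1}" by auto
  next
    fix i n assume "i \<in> I"
    then have "X i (n + M) = X i n"
    proof (rule I_cases)
      assume "i = 4"
      have "(n + M) mod 4 = n mod 4" unfolding M_def by presburger
      then show ?thesis using \<open>i = 4\<close> by (simp add: X4 chi4_def)
    next
      assume "i = 8"
      have "(n + M) mod 8 = n mod 8" unfolding M_def by presburger
      then show ?thesis using \<open>i = 8\<close> by (simp add: X8 chi8_def)
    next
      assume i: "i \<in> P"
      have "[int (n + M) = int n] (mod int i)"
        using dvdM[OF i] by (simp add: cong_iff_dvd_diff)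
      then show ?thesis unfolding XP[OF i] by (rule Legendre_cong)
    qed
    then show "real_of_int (X i (n + M)) = real_of_int (X i n)" by simp
  next
    fix i n assume i: "i \<in> I" and cop: "coprime n M"
    have "coprime n 2" using cop by (auto simp: M_def)
    then have "odd n" by simp
    from i have "X i n \<noteq> 0"
    proof (rule I_cases)
      assume "i = 4"
      then show ?thesis using \<open>odd n\<close> by (simp add: X4 chi4_def) presburger
    next
      assume "i = 8"
      then show ?thesis using \<open>odd n\<close> by (simp add: X8 chi8_def) presburger
    next
      assume i: "i \<in> P"
      then have "\<not> i dvd n"
        using cop dvdM[OF i] P[OF i] by (metis coprime_common_divisor not_prime_unit)
      then show ?thesis unfolding XP[OF i] by (simp add: Legendre_eq_0_iff)
    qed
    then show "real_of_int (X i n) \<noteq> 0" by simp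
  next
    fix i assume i: "i \<in> I"
    obtain v where v: "\<And>p. p \<in> P \<Longrightarrow> Legendre (int (v p)) (int p) = -1"
      using ex_nonresidue P by metis
    define A where "A = insert 8 P"
    \<comment> \<open>Modulo 8, the residue 7 flips only \<open>chi4\<close> and 5 flips only
      \<open>chi8\<close>; modulo \<open>i\<close> in \<open>P\<close> a nonresidue is taken, and 1
      everywhere else.\<close>
    define u where "u j = (if j = 8 then (if i = 4 then 7 else if i = 8 then 5 else 1)
      else if j = i then v j else 1)" for j :: nat
    have odd_cop: "coprime 8 p" "coprime p 8" if "p \<in> P" for p
    proof -
      have "odd p" using P[OF that] by (auto simp: prime_odd_nat)
      then have "coprime (2 ^ 3) p" by (subst coprime_power_left_iff) auto
      then show "coprime 8 p" "coprime p 8" by (auto simp: coprime_commute)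
    qed
    have "\<exists>a. \<forall>j\<in>A. [a = u j] (mod j)"
      by (rule chinese_remainder_nat)
         (use fin P odd_cop in \<open>auto simp: A_def intro: primes_coprime\<close>)
    then obtain a where a: "\<And>j. j \<in> A \<Longrightarrow> [a = u j] (mod j)" by blast
    have "a mod 8 = u 8 mod 8" using a[of 8] by (simp add: A_def cong_def)
    then have a8: "a mod 8 = (if i = 4 then 7 else if i = 8 then 5 else 1)" by (simp add: u_def)
    have "a mod 4 = a mod 8 mod 4" by (simp add: mod_mod_cancel)
    then have a4: "a mod 4 = (if i = 4 then 3 else 1)" unfolding a8 by simp
    have chi4_a: "chi4 a = (if i = 4 then -1 else 1)" by (simp add: chi4_def a4)
    have chi8_a: "chi8 a = (if i = 8 then -1 else 1)" by (simp add: chi8_def a8)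
    have Leg_a: "Legendre (int a) (int p) = (if p = i then -1 else 1)" if p: "p \<in> P" for p
    proof -
      have "[int a = int (u p)] (mod int p)" using a[of p] p by (simp add: A_def cong_int_iff)
      then have "Legendre (int a) (int p) = Legendre (int (u p)) (int p)" by (rule Legendre_cong)
      then show ?thesis using p no v[OF p] P[OF p] by (auto simp: u_def Legendre_1)
    qed
    have "odd a" using a8 by (auto split: if_splits) presburger+
    then have "coprime a 2" by simp
    then have "coprime a (2 ^ 3)" by (subst coprime_power_right_iff) auto
    then have "coprime a 8" by simp
    moreover have "coprime a p" if p: "p \<in> P" for p
    proof -
      have "\<not> int p dvd int a" using Leg_a[OF p] Legendre_eq_0_iff[of "int a" "int p"] by (auto split: if_splits)
      then have "\<not> p dvd a" by simp
      then show ?thesis using P[OF p] by (metis coprime_commute prime_imp_coprime)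
    qed
    ultimately have "coprime a M" unfolding M_def by (auto intro: prod_coprime_right)
    moreover have "X i a = -1"
      using i by (rule I_cases) (simp_all add: X4 X8 chi4_a chi8_a XP Leg_a)
    moreover have "X j a = 1" if "j \<in> I - {i}" for j
    proof -
      have "j \<in> I" "j \<noteq> i" using that by auto
      then show ?thesis
        by (rule_tac I_cases[of j]) (simp_all add: X4 X8 chi4_a chi8_a XP Leg_a)
    qed
    ultimately show "\<exists>a. coprime a M \<and> real_of_int (X i a) = -1 \<and> (\<forall>j\<in>I - {i}. real_of_int (X j a) = 1)"
      by (intro exI[of _ a]) auto
  next
    fix i assume "i \<in> I"
    then have "e' i \<in> {-1, 1}"
      by (rule I_cases) (use r no e in \<open>auto simp: e'_def chi4_def chi8_def\<close>)
    then show "real_of_int (e' i) \<in> {-1, 1}" by auto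
  qed
  then obtain q where q: "q > K" "prime q" "\<And>i. i \<in> I \<Longrightarrow> X i q = e' i" by auto
  have "q mod 8 = r"
    using q(3)[of 4] q(3)[of 8] by (intro mod_8_eq_if_chi_eq r) (simp_all add: I_def X4 X8 e'_def)
  moreover have "Legendre (int q) (int p) = e p" if "p \<in> P" for p
    using q(3)[of p] that no by (auto simp: I_def XP e'_def)
  ultimately show ?thesis using q by blast
qed

section \<open>Consequences of quadratic reciprocity\<close>

lemma Legendre_minus_2:
  assumes "prime p" "2 < p"
  shows "Legendre (-2) (int p) = chi4 p * chi8 p" "chi4 p \<in> {-1, 1}" "chi8 p \<in> {-1, 1}"
proof -
  show "Legendre (-2) (int p) = chi4 p * chi8 p"
    using Legendre_mult[OF assms, of "-1" 2] Legendre_minus_1[OF assms] Legendre_2[OF assms] by simp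
  have "odd p" using assms by (simp add: prime_odd_nat)
  then show "chi4 p \<in> {-1, 1}" "chi8 p \<in> {-1, 1}" by (auto simp: chi4_def chi8_def) presburger+
qed

text \<open>The reciprocity sign is 1 if \<open>q mod 4 = 1\<close> and \<open>chi4 p\<close>
  otherwise. With the symbol of \<open>q\<close> at \<open>p\<close> fixed as
  \<open>chi4 p * chi8 p\<close>, the outcome depends only on \<open>q\<close> modulo 4 and
  \<open>\<Prod>P\<close> modulo 8.\<close>

lemma Legendre_prod_primes:
  fixes P :: "nat set"
  assumes "finite P" and P: "\<And>p. p \<in> P \<Longrightarrow> prime p \<and> 2 < p"
    and q: "prime q" "2 < q" "q \<notin> P"
    and L: "\<And>p. p \<in> P \<Longrightarrow> Legendre (int q) (int p) = Legendre (-2) (int p)"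
  shows "Legendre (int (\<Prod>P)) (int q) =
    (if q mod 4 = 1 then chi4 (\<Prod>P) * chi8 (\<Prod>P) else chi8 (\<Prod>P))"
proof -
  have each: "Legendre (int p) (int q) = (if q mod 4 = 1 then chi4 p * chi8 p else chi8 p)" if p: "p \<in> P" for p
  proof -
    have pp: "prime p" "2 < p" "p \<noteq> q" using P[OF p] p q by auto
    have "odd p" "odd q" using pp q by (auto simp: prime_odd_nat)
    have "(-1::int) ^ ((p - 1) div 2 * ((q - 1) div 2)) = chi4 p ^ ((q - 1) div 2)"
      by (simp only: power_mult minus_one_power_half[OF \<open>odd p\<close>])
    also have "\<dots> = (if q mod 4 = 1 then 1 else chi4 p)"
    proof (cases "q mod 4 = 1")
      case True
      then have "even ((q - 1) div 2)" by presburger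
      then show ?thesis using True Legendre_minus_2(2)[OF pp(1,2)] by auto
    next
      case False
      then have "odd ((q - 1) div 2)" using \<open>odd q\<close> by presburger
      then show ?thesis using False Legendre_minus_2(2)[OF pp(1,2)] by auto
    qed
    finally have "Legendre (int p) (int q) * (chi4 p * chi8 p) = (if q mod 4 = 1 then 1 else chi4 p)"
      using Quadratic_Reciprocity[OF pp(1,2) q(1,2) pp(3)] L[OF p] Legendre_minus_2(1)[OF pp(1,2)] by simp
    then show ?thesis
      using Legendre_minus_2(2,3)[OF pp(1,2)] by (auto split: if_splits)
  qed
  have "Legendre (int (\<Prod>P)) (int q) = (\<Prod>p\<in>P. Legendre (int p) (int q))"
    using Legendre_prod[OF q(1,2) assms(1), of int] by simp
  also have "\<dots> = (\<Prod>p\<in>P. if q mod 4 = 1 then chi4 p * chi8 p else chi8 p)"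
    by (intro prod.cong refl each)
  also have "\<dots> = (if q mod 4 = 1 then chi4 (\<Prod>P) * chi8 (\<Prod>P) else chi8 (\<Prod>P))"
    using chi4_prod[OF assms(1), of id] chi8_prod[OF assms(1), of id] by (simp add: prod.distrib)
  finally show ?thesis .
qed

text \<open>Reciprocity makes the symbol of 3 equal to \<open>chi4 q\<close>, which cancels against
  the symbol of -1.\<close>

lemma Legendre_minus_3:
  assumes "prime q" "3 < q" "q mod 3 = 1"
  shows "Legendre (-3) (int q) = 1"
proof -
  have "odd q" using assms by (auto simp: prime_odd_nat)
  have "[int q = 1] (mod int 3)" using assms(3) by (simp add: cong_def zmod_int[symmetric]) presburger
  then have "Legendre (int q) (int 3) = 1" using Legendre_cong[of "int q" 1 "int 3"] Legendre_1[of 3] by simp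
  then have "Legendre 3 (int q) = (-1) ^ ((q - 1) div 2)"
    using Quadratic_Reciprocity[of 3 q] assms by simp
  then have "Legendre 3 (int q) = chi4 q" unfolding minus_one_power_half[OF \<open>odd q\<close>] .
  then have "Legendre (-3) (int q) = chi4 q * chi4 q"
    using Legendre_mult[of q "-1" 3] Legendre_minus_1[of q] assms by simp
  then show ?thesis using Legendre_minus_2(2)[of q] assms by auto
qed

section \<open>The ternary form\<close>

lemma prime_mult_not_square:
  fixes p m j :: int
  assumes "prime p" "\<not> p dvd m"
  shows "j\<^sup>2 \<noteq> p * m"
proof
  assume j: "j\<^sup>2 = p * m"
  then have "p dvd j" using assms(1) by (metis dvd_triv_left prime_dvd_power)
  then obtain k where "j = p * k" by blast
  then have "p * (p * k\<^sup>2) = p * m" using j by (simp add: power2_eq_square algebra_simps)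
  then have "m = p * k\<^sup>2" using assms(1) by (metis mult_cancel_left not_prime_0)
  then show False using assms(2) by simp
qed

text \<open>A pigeonhole on a box of more than \<open>abc\<close> points gives \<open>(x,y,z) \<noteq> 0\<close> with \<open>ax\<^sup>2 + by\<^sup>2 - cz\<^sup>2\<close>
  equal to 0 or \<open>abc\<close>; composition of forms turns the second case into the first.\<close>
theorem legendre_equation_solvable:
  fixes a b c k1 k2 k3 :: int
  assumes pos: "a > 0" "b > 0" "c > 0"
    and cop: "coprime a b" "coprime a c" "coprime b c"
    and k1: "c dvd a * k1\<^sup>2 + b" and k2: "a dvd b * k2\<^sup>2 - c" and k3: "b dvd a * k3\<^sup>2 - c"
    and nsq: "\<And>j. j\<^sup>2 \<noteq> a * b" "\<And>j. j\<^sup>2 \<noteq> b * c"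
  shows "\<exists>x y z. a * x\<^sup>2 + b * y\<^sup>2 = c * z\<^sup>2 \<and> z \<noteq> 0"
proof -
  define rt where "rt m = int (floor_sqrt (nat m))" for m :: int
  have rt_le: "(rt m)\<^sup>2 \<le> m" and rt_gt: "m < (rt m + 1)\<^sup>2" and rt_0: "rt m \<ge> 0" if "m > 0" for m
  proof -
    have "(floor_sqrt (nat m))\<^sup>2 \<le> nat m" by simp
    then have "int ((floor_sqrt (nat m))\<^sup>2) \<le> int (nat m)" by (rule of_nat_mono)
    then show "(rt m)\<^sup>2 \<le> m" using that by (simp add: rt_def)
    have "nat m < (Suc (floor_sqrt (nat m)))\<^sup>2" by (rule Suc_floor_sqrt_power2_gt)
    then have "int (nat m) < int ((Suc (floor_sqrt (nat m)))\<^sup>2)" by (simp only: of_nat_less_iff)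
    then show "m < (rt m + 1)\<^sup>2" using that by (simp add: rt_def add.commute)
    show "rt m \<ge> 0" by (simp add: rt_def)
  qed
  have pos2: "b * c > 0" "a * c > 0" "a * b > 0" using pos by auto
  define X Y Z where "X = rt (b * c)" and "Y = rt (a * c)" and "Z = rt (a * b)"
  define box where "box = {0..X} \<times> {0..Y} \<times> {0..Z}"
  \<comment> \<open>Points with equal \<open>g\<close> differ by a vector at which the form vanishes
    modulo \<open>c\<close>, \<open>a\<close> and \<open>b\<close>, by the three divisibility
    hypotheses.\<close>
  define g where "g = (\<lambda>(x, y, z). ((x - k1 * y) mod c, (y - k2 * z) mod a, (x - k3 * z) mod b))"
  have X0: "X \<ge> 0" "Y \<ge> 0" "Z \<ge> 0" using rt_0 pos2 by (auto simp: X_def Y_def Z_def)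
  \<comment> \<open>The three square roots multiply to \<open>a * b * c\<close>, so sides of one
    more than their floors give a box with more points than there are residue triples.\<close>
  have "(a * b * c)\<^sup>2 = (b * c) * ((a * c) * (a * b))" by (simp add: power2_eq_square)
  also have "\<dots> < (X + 1)\<^sup>2 * ((Y + 1)\<^sup>2 * (Z + 1)\<^sup>2)"
    using rt_gt[OF pos2(1)] rt_gt[OF pos2(2)] rt_gt[OF pos2(3)] pos2 X0
    unfolding X_def Y_def Z_def by (intro mult_strict_mono) auto
  also have "\<dots> = ((X + 1) * (Y + 1) * (Z + 1))\<^sup>2" by (simp add: power_mult_distrib)
  finally have abc_less: "a * b * c < (X + 1) * (Y + 1) * (Z + 1)"
    using X0 by (auto intro: power2_less_imp_less)
  have "g ` box \<subseteq> {0..<c} \<times> {0..<a} \<times> {0..<b}"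
    using pos by (auto simp: g_def)
  then have "card (g ` box) \<le> card ({0..<c} \<times> {0..<a} \<times> {0..<b})"
    by (intro card_mono) auto
  also have "int \<dots> = a * b * c" using pos by (simp add: card_cartesian_product)
  finally have "int (card (g ` box)) \<le> a * b * c" by simp
  also have "\<dots> < int (card box)"
    using abc_less X0 by (simp add: box_def card_cartesian_product add.commute)
  finally have "\<not> inj_on g box" by (intro pigeonhole) simp
  then obtain s t where st: "s \<in> box" "t \<in> box" "g s = g t" "s \<noteq> t"
    unfolding inj_on_def by blast
  obtain x1 y1 z1 where s: "s = (x1, y1, z1)" by (cases s)
  obtain x2 y2 z2 where t: "t = (x2, y2, z2)" by (cases t)
  define x y z where "x = x1 - x2" and "y = y1 - y2" and "z = z1 - z2"
  have nz: "x \<noteq> 0 \<or> y \<noteq> 0 \<or> z \<noteq> 0" using st(4) by (auto simp: s t x_def y_def z_def)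
  have bnd: "\<bar>x\<bar> \<le> X" "\<bar>y\<bar> \<le> Y" "\<bar>z\<bar> \<le> Z"
    using st(1,2) by (auto simp: s t box_def x_def y_def z_def)
  have "x\<^sup>2 \<le> b * c" "y\<^sup>2 \<le> a * c" "z\<^sup>2 \<le> a * b"
    using power_mono[OF bnd(1), of 2] power_mono[OF bnd(2), of 2] power_mono[OF bnd(3), of 2]
      rt_le[OF pos2(1)] rt_le[OF pos2(2)] rt_le[OF pos2(3)]
    by (auto simp: X_def Y_def Z_def)
  \<comment> \<open>\<open>nsq\<close> makes two of the bounds strict, which confines
    \<open>F\<close> strictly between \<open>-1\<close> and \<open>2\<close> times
    \<open>a * b * c\<close>.\<close>
  then have sq: "x\<^sup>2 < b * c" "y\<^sup>2 \<le> a * c" "z\<^sup>2 < a * b"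
    using nsq by (simp_all add: order_less_le)
  have "(x1 - k1 * y1) mod c = (x2 - k1 * y2) mod c" "(y1 - k2 * z1) mod a = (y2 - k2 * z2) mod a"
    "(x1 - k3 * z1) mod b = (x2 - k3 * z2) mod b"
    using st(3) by (auto simp: s t g_def)
  then have dvds: "c dvd x - k1 * y" "a dvd y - k2 * z" "b dvd x - k3 * z"
    by (auto simp: mod_eq_dvd_iff x_def y_def z_def algebra_simps)
  define F where "F = a * x\<^sup>2 + b * y\<^sup>2 - c * z\<^sup>2"
  have "F = (a * k1\<^sup>2 + b) * y\<^sup>2 + (x - k1 * y) * (a * (x + k1 * y)) - c * z\<^sup>2"
    by (simp add: F_def power2_eq_square algebra_simps)
  then have "c dvd F" using k1 dvds(1) by (metis dvd_add dvd_diff dvd_mult2 dvd_triv_left)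
  have "F = (b * k2\<^sup>2 - c) * z\<^sup>2 + (y - k2 * z) * (b * (y + k2 * z)) + a * x\<^sup>2"
    by (simp add: F_def power2_eq_square algebra_simps)
  then have "a dvd F" using k2 dvds(2) by (metis dvd_add dvd_mult2 dvd_triv_left)
  have "F = (a * k3\<^sup>2 - c) * z\<^sup>2 + (x - k3 * z) * (a * (x + k3 * z)) + b * y\<^sup>2"
    by (simp add: F_def power2_eq_square algebra_simps)
  then have "b dvd F" using k3 dvds(3) by (metis dvd_add dvd_mult2 dvd_triv_left)
  have "a * b * c dvd F"
    using \<open>a dvd F\<close> \<open>b dvd F\<close> \<open>c dvd F\<close> cop by (intro divides_mult) auto
  then obtain l where l: "F = (a * b * c) * l" by blast
  have "a * x\<^sup>2 < a * (b * c)" "b * y\<^sup>2 \<le> b * (a * c)" "c * z\<^sup>2 < c * (a * b)"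
    "0 \<le> a * x\<^sup>2" "0 \<le> b * y\<^sup>2" "0 \<le> c * z\<^sup>2"
    using sq pos by simp_all
  then have "(a * b * c) * (-1) < F" "F < (a * b * c) * 2"
    by (simp_all add: F_def algebra_simps)
  then have "-1 < l" "l < 2"
    unfolding l using pos by (simp_all only: mult_less_cancel_left_pos mult_pos_pos)
  then consider "l = 0" | "l = 1" by linarith
  then show ?thesis
  proof cases
    case 1
    then have eq: "a * x\<^sup>2 + b * y\<^sup>2 = c * z\<^sup>2" using l by (simp add: F_def)
    have "z \<noteq> 0"
    proof
      assume "z = 0"
      then have "a * x\<^sup>2 + b * y\<^sup>2 = 0" using eq by simp
      moreover have "0 \<le> a * x\<^sup>2" "0 \<le> b * y\<^sup>2" using pos by simp_all
      ultimately have "a * x\<^sup>2 = 0" "b * y\<^sup>2 = 0" by linarith+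
      then show False using nz \<open>z = 0\<close> pos by auto
    qed
    then show ?thesis using eq by blast
  next
    case 2
    then have eq: "a * x\<^sup>2 + b * y\<^sup>2 = c * (z\<^sup>2 + a * b)" using l by (simp add: F_def algebra_simps)
    have "a * (x * z + b * y)\<^sup>2 + b * (y * z - a * x)\<^sup>2 = (a * x\<^sup>2 + b * y\<^sup>2) * (z\<^sup>2 + a * b)"
      by (simp add: power2_eq_square algebra_simps)
    also have "\<dots> = c * (z\<^sup>2 + a * b)\<^sup>2" unfolding eq by (simp add: power2_eq_square)
    finally have "a * (x * z + b * y)\<^sup>2 + b * (y * z - a * x)\<^sup>2 = c * (z\<^sup>2 + a * b)\<^sup>2" .
    moreover have "z\<^sup>2 + a * b \<noteq> 0" using pos2(3) by (smt (verit) zero_le_power2)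
    ultimately show ?thesis by blast
  qed
qed

section \<open>Descent from rational to integral representations\<close>

definition ternary :: "int \<Rightarrow> int \<Rightarrow> int \<Rightarrow> int" where
  "ternary x z w = 2 * x\<^sup>2 + (z\<^sup>2 + z * w + w\<^sup>2)"

lemma ex_nearest_multiple:
  fixes t x :: int
  assumes "t > 0"
  shows "\<exists>y. 4 * (x - t * y)\<^sup>2 \<le> t\<^sup>2"
proof -
  define y where "y = (2 * x + t) div (2 * t)"
  have "2 * x + t = 2 * t * y + (2 * x + t) mod (2 * t)" unfolding y_def by simp
  moreover have "0 \<le> (2 * x + t) mod (2 * t)" "(2 * x + t) mod (2 * t) < 2 * t" using assms by simp_all
  ultimately have "\<bar>2 * (x - t * y)\<bar> \<le> t" by (simp add: abs_le_iff algebra_simps)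
  then have "(2 * (x - t * y))\<^sup>2 \<le> t\<^sup>2" using assms by (intro abs_le_square_iff[THEN iffD1]) simp
  moreover have "(2 * (x - t * y))\<^sup>2 = 4 * (x - t * y)\<^sup>2" by (simp only: power_mult_distrib) simp
  ultimately show ?thesis by (intro exI[of _ y]) simp
qed

text \<open>The Aubry--Davenport--Cassels descent; it applies because every rational point is within
  distance 15/16, measured by the form, of an integral one.\<close>
theorem ternary_rational_imp_integral:
  assumes "t > 0" "n * t\<^sup>2 = ternary x z w"
  shows "\<exists>x z w. n = ternary x z w"
  using assms
proof (induction "nat t" arbitrary: t x z w rule: less_induct)
  case less
  obtain x0 where x0: "4 * (x - t * x0)\<^sup>2 \<le> t\<^sup>2" using ex_nearest_multiple[OF less.prems(1)] by blast
  obtain w0 where w0: "4 * (w - t * w0)\<^sup>2 \<le> t\<^sup>2" using ex_nearest_multiple[OF less.prems(1)] by blast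
  \<comment> \<open>\<open>z0\<close> is chosen after \<open>w0\<close>, so that the remainder of
    \<open>2 * z + w\<close>, which appears when the square is completed, is small.\<close>
  obtain z0 where "4 * (2 * z + (w - t * w0) - 2 * t * z0)\<^sup>2 \<le> (2 * t)\<^sup>2"
    using ex_nearest_multiple[of "2 * t" "2 * z + (w - t * w0)"] less.prems(1) by auto
  then have z0: "(2 * (z - t * z0) + (w - t * w0))\<^sup>2 \<le> t\<^sup>2"
    by (simp add: power_mult_distrib algebra_simps)
  define D where "D = ternary (x - t * x0) (z - t * z0) (w - t * w0)"
  \<comment> \<open>Each square in parentheses is at most \<open>t ^ 2\<close>, so the weights 8, 4
    and 3 add up to 15.\<close>
  have D_eq: "16 * D = 8 * (4 * (x - t * x0)\<^sup>2) + 4 * (2 * (z - t * z0) + (w - t * w0))\<^sup>2 + 3 * (4 * (w - t * w0)\<^sup>2)"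
    by (simp add: D_def ternary_def power2_eq_square algebra_simps)
  have t2: "0 < t\<^sup>2" using less.prems(1) by simp
  have "16 * D \<le> 15 * t\<^sup>2" unfolding D_eq using x0 w0 z0 by linarith
  then have D_less: "D < t\<^sup>2" using t2 by linarith
  \<comment> \<open>\<open>\<beta>\<close> is the polar bilinear form of \<open>ternary\<close> at
    the given and the rounded point.\<close>
  define \<beta> where "\<beta> = 4 * x * x0 + 2 * z * z0 + z * w0 + w * z0 + 2 * w * w0"
  define f0 where "f0 = ternary x0 z0 w0"
  define t' where "t' = n * t - \<beta> + t * f0"
  have "D = ternary x z w - t * \<beta> + t\<^sup>2 * f0"
    by (simp add: D_def ternary_def \<beta>_def f0_def power2_eq_square algebra_simps)
  then have D_t: "D = t * t'"
    unfolding less.prems(2)[symmetric] t'_def by (simp add: power2_eq_square algebra_simps)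
  show ?case
  proof (cases "D = 0")
    case True
    have "(x - t * x0)\<^sup>2 \<ge> 0" "(2 * (z - t * z0) + (w - t * w0))\<^sup>2 \<ge> 0" "(w - t * w0)\<^sup>2 \<ge> 0" by simp_all
    then have "(x - t * x0)\<^sup>2 = 0" "(2 * (z - t * z0) + (w - t * w0))\<^sup>2 = 0" "(w - t * w0)\<^sup>2 = 0"
      using D_eq True by linarith+
    then have "x = t * x0" "z = t * z0" "w = t * w0" by auto
    then have "n * t\<^sup>2 = f0 * t\<^sup>2"
      using less.prems(2) by (simp add: f0_def ternary_def power2_eq_square algebra_simps)
    then have "n = f0" using t2 by simp
    then show ?thesis unfolding f0_def by blast
  next
    case False
    have "D \<ge> 0"
      using D_eq zero_le_power2[of "x - t * x0"] zero_le_power2[of "2 * (z - t * z0) + (w - t * w0)"]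
        zero_le_power2[of "w - t * w0"] by linarith
    then have "0 < t * t'" using False D_t by linarith
    then have t'0: "t' > 0" using less.prems(1) by (simp add: zero_less_mult_iff)
    have "t * t' < t * t" using D_less D_t by (simp add: power2_eq_square)
    then have t'_less: "t' < t" using less.prems(1) by simp
    \<comment> \<open>The line through the rational point and the rounded one meets the quadric
      again in the combination with these coefficients, over the smaller denominator
      \<open>t' = a * t + b\<close>.\<close>
    define a b where "a = f0 - n" and "b = 2 * n * t - \<beta>"
    have t'_eq: "t' = a * t + b" by (simp add: t'_def a_def b_def algebra_simps)
    have "ternary (a * x + b * x0) (a * z + b * z0) (a * w + b * w0) = a\<^sup>2 * ternary x z w + a * b * \<beta> + b\<^sup>2 * f0"
      by (simp add: ternary_def \<beta>_def f0_def power2_eq_square algebra_simps)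
    also have "\<dots> = n * t'\<^sup>2 + a * b * (\<beta> - 2 * n * t) + b\<^sup>2 * (f0 - n)"
      unfolding less.prems(2)[symmetric] t'_eq by (simp add: power2_eq_square algebra_simps)
    also have "\<dots> = n * t'\<^sup>2"
      unfolding a_def[symmetric] by (simp add: b_def power2_eq_square algebra_simps)
    finally have "n * t'\<^sup>2 = ternary (a * x + b * x0) (a * z + b * z0) (a * w + b * w0)" by simp
    then show ?thesis using less.hyps[of t'] t'0 t'_less by auto
  qed
qed

section \<open>Squarefree numbers represented by the ternary form\<close>

lemma squarefree_eq_prod_prime_factors:
  fixes n :: nat
  assumes "squarefree n"
  shows "n = \<Prod>(prime_factors n)"
proof -
  have n: "n \<noteq> 0" using assms not_squarefree_0 by metis
  have "multiplicity p n = 1" if "p \<in> prime_factors n" for p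
    using that assms n by (simp add: squarefree_factorial_semiring')
  then show ?thesis using prod_prime_factors[OF n] by simp
qed

text \<open>The symbols of \<open>q\<close> and -2 are made to agree at every prime of
  \<open>n\<close>, so \<open>-2 * q\<close> is a square modulo \<open>n\<close>. Adding 3 to these
  primes forces \<open>q mod 3 = 1\<close>, as -2 is a square modulo 3. Reciprocity then gives the
  symbol of \<open>n\<close> at \<open>q\<close>.\<close>

lemma ex_auxiliary_prime:
  fixes n :: nat
  assumes n: "squarefree n" "odd n" and r: "r \<in> {1, 3, 5, 7}"
  shows "\<exists>q>max n 3. prime q \<and> q mod 8 = r \<and> q mod 3 = 1 \<and> (\<exists>k. int n dvd k\<^sup>2 + 2 * int q) \<and>
    Legendre (int n) (int q) = (if q mod 4 = 1 then chi4 n * chi8 n else chi8 n)"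
proof -
  define P where "P = prime_factors n"
  have n_eq: "n = \<Prod>P" unfolding P_def by (rule squarefree_eq_prod_prime_factors[OF n(1)])
  have finP: "finite P" by (simp add: P_def)
  have P: "prime p \<and> 2 < p" if "p \<in> insert 3 P" for p
  proof (cases "p = 3")
    case False
    then have "prime p" "p dvd n" using that by (auto simp: P_def)
    then have "odd p" using n(2) by auto
    then have "p \<noteq> 2" by auto
    then show ?thesis using \<open>prime p\<close> prime_ge_2_nat[of p] by auto
  qed auto
  obtain q where q: "q > max n 3" "prime q" "q mod 8 = r"
    and L: "\<And>p. p \<in> insert 3 P \<Longrightarrow> Legendre (int q) (int p) = Legendre (-2) (int p)"
  proof -
    have "\<exists>q>max n 3. prime q \<and> q mod 8 = r \<and>
        (\<forall>p\<in>insert 3 P. Legendre (int q) (int p) = Legendre (-2) (int p))"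
    proof (rule ex_prime_with_Legendre[OF _ P _ r])
      show "Legendre (-2) (int p) \<in> {-1, 1}" if "p \<in> insert 3 P" for p
        using Legendre_minus_2[of p] P[OF that] by auto
    qed (use finP in auto)
    then show ?thesis using that by blast
  qed
  have "Legendre (-2) 3 = (1::int)"
    using Legendre_cong[of "-2" 1 3] Legendre_1[of 3] by (simp add: cong_iff_dvd_diff)
  then have "Legendre (int q) 3 = 1" using L[of 3] by simp
  then obtain y where y: "3 dvd y\<^sup>2 - int q" using Legendre_eq_1D by blast
  have "\<not> (3::int) dvd int q"
    using \<open>Legendre (int q) 3 = 1\<close> Legendre_eq_0_iff[of "int q" 3] by auto
  have "q mod 3 = 1"
  proof -
    have "y mod 3 = 0 \<or> y mod 3 = 1 \<or> y mod 3 = 2" by presburger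
    moreover have "y\<^sup>2 mod 3 = (y mod 3)\<^sup>2 mod 3" by (simp add: power_mod)
    ultimately have "y\<^sup>2 mod 3 = 0 \<or> y\<^sup>2 mod 3 = 1" by auto
    then show ?thesis using y \<open>\<not> 3 dvd int q\<close> by presburger
  qed
  moreover have "\<exists>k. int n dvd k\<^sup>2 + 2 * int q"
  proof -
    have "Legendre (-2 * int q) (int p) = 1" if p: "p \<in> P" for p
    proof -
      have pp: "prime p" "2 < p" using P p by auto
      have "Legendre (-2 * int q) (int p) = Legendre (-2) (int p) * Legendre (int q) (int p)"
        by (rule Legendre_mult[OF pp])
      then show ?thesis using L[of p] p Legendre_minus_2[OF pp] by auto
    qed
    then have "\<exists>k. int (\<Prod>P) dvd k\<^sup>2 - (-2 * int q)"
      using finP P by (intro ex_root_mod_prod) auto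
    then show ?thesis by (simp add: n_eq[symmetric])
  qed
  moreover have "q \<notin> P"
  proof
    assume "q \<in> P"
    then have "q dvd n" by (auto simp: P_def dest: in_prime_factors_imp_dvd)
    then show False using q(1) n(2) by (auto dest: dvd_imp_le intro: Nat.gr0I)
  qed
  then have "Legendre (int (\<Prod>P)) (int q) =
    (if q mod 4 = 1 then chi4 (\<Prod>P) * chi8 (\<Prod>P) else chi8 (\<Prod>P))"
    using q L P by (intro Legendre_prod_primes finP) auto
  ultimately show ?thesis using q unfolding n_eq[symmetric] by blast
qed

text \<open>Since -3 is a square modulo \<open>q\<close>, Legendre's equation yields
  \<open>q * s ^ 2 = u ^ 2 + 3 * v ^ 2\<close>, and the right side is
  \<open>z ^ 2 + z * w + w ^ 2\<close> at \<open>z = u - v\<close>, \<open>w = 2 * v\<close>. The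
  descent removes the denominator.\<close>

lemma ternary_represents_if_form_zero:
  fixes n x y z :: int
  assumes q: "prime q" "3 < q" "q mod 3 = 1"
    and eq: "n * z\<^sup>2 = 2 * x\<^sup>2 + int q * y\<^sup>2" and "z \<noteq> 0"
  shows "\<exists>x z w. n = ternary x z w"
proof -
  have q3: "\<not> int 3 dvd int q" using q(3) by presburger
  obtain k where k: "int q dvd k\<^sup>2 - (-3)" using Legendre_eq_1D[OF Legendre_minus_3[OF q]] by blast
  have "\<exists>u v s. 1 * u\<^sup>2 + 3 * v\<^sup>2 = int q * s\<^sup>2 \<and> s \<noteq> 0"
  proof (rule legendre_equation_solvable)
    show "int q dvd 1 * k\<^sup>2 + 3" using k by simp
    have "(3::int) dvd 1 - int q" using q(3) by presburger
    then show "(3::int) dvd 1 * 1\<^sup>2 - int q" by simp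
    show "(1::int) dvd 3 * 0\<^sup>2 - int q" by simp
    have "prime (3::int)" by simp
    then show "j\<^sup>2 \<noteq> 1 * 3" "j\<^sup>2 \<noteq> 3 * int q" for j :: int
      using prime_mult_not_square[of 3 1 j] prime_mult_not_square[of 3 "int q" j] q3 by simp_all
    show "coprime (3::int) (int q)"
      using q3 \<open>prime (3::int)\<close> by (intro prime_imp_coprime) simp_all
  qed (use q in auto)
  then obtain u v s where uvs: "u\<^sup>2 + 3 * v\<^sup>2 = int q * s\<^sup>2" "s \<noteq> 0" by auto
  have "n * \<bar>z * s\<bar>\<^sup>2 = (n * z\<^sup>2) * s\<^sup>2" by (simp add: power_mult_distrib)
  also have "\<dots> = 2 * (x * s)\<^sup>2 + (int q * s\<^sup>2) * y\<^sup>2"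
    unfolding eq by (simp add: power_mult_distrib algebra_simps)
  also have "\<dots> = ternary (x * s) (u * y - v * y) (2 * (v * y))"
    unfolding uvs(1)[symmetric] ternary_def by (simp add: power2_eq_square algebra_simps)
  finally show ?thesis
    using ternary_rational_imp_integral[of "\<bar>z * s\<bar>"] \<open>z \<noteq> 0\<close> \<open>s \<noteq> 0\<close> by simp
qed

text \<open>An even root can be halved, and adding the odd \<open>n\<close> makes an odd root even.
  This gives the shape required by Legendre's equation with leading coefficient 2.\<close>

lemma half_root:
  fixes n c k :: int
  assumes "odd n" "n dvd k\<^sup>2 - 2 * c"
  shows "\<exists>j. n dvd 2 * j\<^sup>2 - c"
proof -
  obtain j where j: "n dvd (2 * j)\<^sup>2 - 2 * c"
  proof (cases "even k")
    case True
    then show ?thesis using assms(2) that[of "k div 2"] by simp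
  next
    case False
    then have "even (k + n)" using assms(1) by simp
    then obtain j where "k + n = 2 * j" by blast
    moreover have "(k + n)\<^sup>2 - 2 * c = (k\<^sup>2 - 2 * c) + n * (2 * k + n)"
      by (simp add: power2_eq_square algebra_simps)
    then have "n dvd (k + n)\<^sup>2 - 2 * c" using assms(2) by (metis dvd_add dvd_triv_left)
    ultimately show ?thesis using that[of j] by simp
  qed
  moreover have "(2 * j)\<^sup>2 - 2 * c = 2 * (2 * j\<^sup>2 - c)" by (simp add: power_mult_distrib)
  ultimately have "n dvd 2 * (2 * j\<^sup>2 - c)" by (simp only:)
  moreover have "coprime n 2" using assms(1) by simp
  ultimately have "n dvd 2 * j\<^sup>2 - c" by (simp only: coprime_dvd_mult_right_iff)
  then show ?thesis by blast
qed

text \<open>Solves \<open>2 * x ^ 2 + q * y ^ 2 = n * z ^ 2\<close>. The condition modulo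
  \<open>n\<close> is built into \<open>q\<close>; the one modulo \<open>q\<close> says that
  \<open>2 * n\<close> is a square there.\<close>

lemma ternary_represents_odd_squarefree:
  fixes n :: nat
  assumes n: "squarefree n" "odd n"
  shows "\<exists>x z w. int n = ternary x z w"
proof -
  \<comment> \<open>Both choices are 1 modulo 4, and \<open>chi8 q\<close> is 1 or -1 accordingly,
    so that \<open>chi8 q * (chi4 n * chi8 n) = 1\<close>.\<close>
  define r where "r = (if chi4 n * chi8 n = 1 then 1 else 5 :: nat)"
  have "r \<in> {1, 3, 5, 7}" by (simp add: r_def)
  then obtain q k where q: "q > max n 3" "prime q" "q mod 8 = r" "q mod 3 = 1"
    and k: "int n dvd k\<^sup>2 + 2 * int q"
    and L: "Legendre (int n) (int q) = (if q mod 4 = 1 then chi4 n * chi8 n else chi8 n)"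
    using ex_auxiliary_prime[OF n] by blast
  have n0: "n > 0" using n by (auto intro: Nat.gr0I)
  have "odd q" using q by (auto simp: prime_odd_nat)
  have "q mod 4 = q mod 8 mod 4" by (simp add: mod_mod_cancel)
  then have "q mod 4 = 1" unfolding q(3) by (simp add: r_def)
  then have L2: "Legendre (2 * int n) (int q) = chi8 q * (chi4 n * chi8 n)"
    using Legendre_mult[of q 2 "int n"] Legendre_2[of q] L q by simp
  have "chi4 n * chi8 n = 1 \<or> chi4 n * chi8 n = -1"
  proof -
    have "n mod 8 = 1 \<or> n mod 8 = 3 \<or> n mod 8 = 5 \<or> n mod 8 = 7" using n(2) by presburger
    moreover have "n mod 4 = n mod 8 mod 4" by (simp add: mod_mod_cancel)
    ultimately show ?thesis by (auto simp: chi4_def chi8_def)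
  qed
  moreover have "chi8 q = (if chi4 n * chi8 n = 1 then 1 else -1)"
    by (simp add: chi8_def[of q] q(3) r_def)
  ultimately have "chi8 q * (chi4 n * chi8 n) = 1" by auto
  then have "Legendre (2 * int n) (int q) = 1" using L2 by simp
  then obtain k' where k': "int q dvd k'\<^sup>2 - 2 * int n" using Legendre_eq_1D by blast
  have qn: "\<not> int q dvd int n" using q(1) n0 by (auto dest: dvd_imp_le)
  obtain k1 where k1: "int n dvd 2 * k1\<^sup>2 - (- int q)"
    using half_root[of "int n" k "- int q"] k n by auto
  obtain k3 where k3: "int q dvd 2 * k3\<^sup>2 - int n"
    using half_root[of "int q" k' "int n"] k' \<open>odd q\<close> by auto
  have "\<exists>x y z. 2 * x\<^sup>2 + int q * y\<^sup>2 = int n * z\<^sup>2 \<and> z \<noteq> 0"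
  proof (rule legendre_equation_solvable)
    show "int n dvd 2 * k1\<^sup>2 + int q" using k1 by simp
    show "2 dvd int q * 1\<^sup>2 - int n" using n(2) \<open>odd q\<close> by simp
    show "int q dvd 2 * k3\<^sup>2 - int n" by (rule k3)
    show "j\<^sup>2 \<noteq> 2 * int q" "j\<^sup>2 \<noteq> int q * int n" for j
      using prime_mult_not_square[of 2 "int q" j] prime_mult_not_square[of "int q" "int n" j] \<open>odd q\<close> q qn
      by simp_all
    show "coprime (int q) (int n)" using qn q by (intro prime_imp_coprime) simp_all
  qed (use q n n0 \<open>odd q\<close> in auto)
  then obtain x y z where "2 * x\<^sup>2 + int q * y\<^sup>2 = int n * z\<^sup>2" "z \<noteq> 0" by blast
  then show ?thesis using ternary_represents_if_form_zero[of q "int n" z x y] q by auto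
qed

text \<open>Solves \<open>x ^ 2 + 2 * q * y ^ 2 = m * z ^ 2\<close> and doubles it. Here
  \<open>m\<close> must be a square modulo \<open>q\<close>; for \<open>m mod 8 = 5\<close> both
  possible values of its symbol are -1.\<close>

lemma ternary_represents_even_squarefree:
  fixes m :: nat
  assumes m: "squarefree m" "odd m" "m mod 8 \<noteq> 5"
  shows "\<exists>x z w. 2 * int m = ternary x z w"
proof -
  \<comment> \<open>For \<open>m mod 8 = 7\<close> the symbol of \<open>m\<close> at
    \<open>q\<close> is 1 only if \<open>q mod 4 = 3\<close>; for 1 and 3 it is 1 when
    \<open>q mod 4 = 1\<close>.\<close>
  define r where "r = (if m mod 8 = 7 then 3 else 1 :: nat)"
  have "r \<in> {1, 3, 5, 7}" by (simp add: r_def)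
  then obtain q k where q: "q > max m 3" "prime q" "q mod 8 = r" "q mod 3 = 1"
    and k: "int m dvd k\<^sup>2 + 2 * int q"
    and L: "Legendre (int m) (int q) = (if q mod 4 = 1 then chi4 m * chi8 m else chi8 m)"
    using ex_auxiliary_prime[OF m(1,2)] by blast
  have m0: "m > 0" using m by (auto intro: Nat.gr0I)
  have "odd q" using q by (auto simp: prime_odd_nat)
  have q4: "q mod 4 = r mod 4" unfolding q(3)[symmetric] by (simp add: mod_mod_cancel)
  have "m mod 8 = 1 \<or> m mod 8 = 3 \<or> m mod 8 = 7" using m by presburger
  moreover have "m mod 4 = m mod 8 mod 4" by (simp add: mod_mod_cancel)
  ultimately have "Legendre (int m) (int q) = 1"
    unfolding L q4 by (auto simp: r_def chi4_def chi8_def)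
  then obtain k' where k': "int q dvd k'\<^sup>2 - int m" using Legendre_eq_1D by blast
  have qm: "\<not> int q dvd int m" using q(1) m0 by (auto dest: dvd_imp_le)
  \<comment> \<open>The root is taken odd so that 2, and hence \<open>2 * q\<close>, divides
    \<open>k3 ^ 2 - m\<close>.\<close>
  obtain k3 where k3: "int q dvd k3\<^sup>2 - int m" "odd k3"
  proof (cases "odd k'")
    case True
    then show ?thesis using k' that by blast
  next
    case False
    have "(k' + int q)\<^sup>2 - int m = (k'\<^sup>2 - int m) + int q * (2 * k' + int q)"
      by (simp add: power2_eq_square algebra_simps)
    then have "int q dvd (k' + int q)\<^sup>2 - int m" using k' by (metis dvd_add dvd_triv_left)
    then show ?thesis using that[of "k' + int q"] False \<open>odd q\<close> by simp
  qed
  have "\<exists>x y z. 1 * x\<^sup>2 + (2 * int q) * y\<^sup>2 = int m * z\<^sup>2 \<and> z \<noteq> 0"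
  proof (rule legendre_equation_solvable)
    show "int m dvd 1 * k\<^sup>2 + 2 * int q" using k by simp
    show "1 dvd 2 * int q * 0\<^sup>2 - int m" by simp
    have "2 dvd k3\<^sup>2 - int m" using k3(2) m(2) by simp
    moreover have "coprime 2 (int q)" using \<open>odd q\<close> by simp
    ultimately show "2 * int q dvd 1 * k3\<^sup>2 - int m" using k3(1) by (simp add: divides_mult)
    show "j\<^sup>2 \<noteq> 1 * (2 * int q)" "j\<^sup>2 \<noteq> 2 * int q * int m" for j
      using prime_mult_not_square[of 2 "int q" j] prime_mult_not_square[of 2 "int q * int m" j] \<open>odd q\<close> m
      by (simp_all add: mult.assoc)
    have "coprime (int q) (int m)" using qm q by (intro prime_imp_coprime) simp_all
    then show "coprime (2 * int q) (int m)" using m(2) by simp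
  qed (use q m m0 in auto)
  then obtain x y z where xyz: "x\<^sup>2 + (2 * int q) * y\<^sup>2 = int m * z\<^sup>2" "z \<noteq> 0" by auto
  then have "2 * int m * z\<^sup>2 = 2 * x\<^sup>2 + int q * (2 * y)\<^sup>2"
    by (simp add: power_mult_distrib algebra_simps)
  then show ?thesis using ternary_represents_if_form_zero[of q "2 * int m" z x "2 * y"] q xyz(2) by auto
qed

section \<open>All numbers represented by the ternary form\<close>

lemma power2_two_power: "(2 ^ k)\<^sup>2 = (4 :: 'a :: comm_semiring_1) ^ k"
proof -
  have "(2 ^ k)\<^sup>2 = (2 * 2 :: 'a) ^ k" by (simp only: power2_eq_square power_mult_distrib)
  then show ?thesis by simp
qed

lemma ternary_scale: "ternary (u * x) (u * z) (u * w) = u\<^sup>2 * ternary x z w"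
  by (simp add: ternary_def power2_eq_square algebra_simps)

lemma odd_square_mod_8: "odd (v::nat) \<Longrightarrow> v\<^sup>2 mod 8 = 1"
proof -
  assume "odd v"
  then have "v mod 8 = 1 \<or> v mod 8 = 3 \<or> v mod 8 = 5 \<or> v mod 8 = 7" by presburger
  moreover have "v\<^sup>2 mod 8 = (v mod 8)\<^sup>2 mod 8" by (simp add: power_mod)
  ultimately show ?thesis by auto
qed

text \<open>Reduces to the squarefree part \<open>s\<close>. If \<open>s mod 16 = 10\<close>, an odd
  square factor keeps this residue, being 1 modulo 8, and the square of \<open>2 ^ k\<close> is
  \<open>4 ^ k\<close>, so \<open>n\<close> would be exceptional.\<close>

theorem ternary_represents:
  fixes n :: nat
  assumes "\<And>k m. n \<noteq> 4 ^ k * (16 * m + 10)"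
  shows "\<exists>x z w. int n = ternary x z w"
proof (cases "n = 0")
  case True
  then show ?thesis by (intro exI[of _ 0]) (simp add: ternary_def)
next
  case False
  define s u where "s = squarefree_part n" and "u = square_part n"
  have n_eq: "n = s * u\<^sup>2" unfolding s_def u_def by (rule squarefree_decompose)
  have sf: "squarefree s" by (simp add: s_def)
  have s16: "s mod 16 \<noteq> 10"
  proof
    assume s10: "s mod 16 = 10"
    have "u > 0" using n_eq False by (auto intro: Nat.gr0I)
    then obtain k v where v: "u = v * 2 ^ k" "\<not> 2 dvd v"
      using prime_power_canonical[of 2 u] two_is_prime_nat by metis
    have "s = 16 * (s div 16) + 10" using s10 by presburger
    moreover have "v\<^sup>2 = 8 * (v\<^sup>2 div 8) + 1" using odd_square_mod_8[OF v(2)] by presburger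
    ultimately have "s * v\<^sup>2 = (16 * (s div 16) + 10) * (8 * (v\<^sup>2 div 8) + 1)" by simp
    also have "\<dots> = 16 * ((s div 16) * (8 * (v\<^sup>2 div 8) + 1) + 5 * (v\<^sup>2 div 8)) + 10"
      by (simp add: algebra_simps)
    finally have "s * v\<^sup>2 = 16 * ((s div 16) * (8 * (v\<^sup>2 div 8) + 1) + 5 * (v\<^sup>2 div 8)) + 10" .
    moreover have "n = 4 ^ k * (s * v\<^sup>2)"
      unfolding n_eq v(1) power_mult_distrib power2_two_power by (simp only: mult_ac)
    ultimately show False using assms by metis
  qed
  have "\<exists>x z w. int s = ternary x z w"
  proof (cases "odd s")
    case True
    then show ?thesis using ternary_represents_odd_squarefree sf by blast
  next
    case False
    then obtain m where m: "s = 2 * m" by blast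
    have "squarefree m" using sf m by (metis dvd_triv_right squarefree_mono)
    moreover have "odd m"
    proof
      assume "even m"
      then have "2\<^sup>2 dvd s" using m by auto
      then have "2 dvd (1::nat)" by (rule squarefreeD[OF sf])
      then show False by simp
    qed
    moreover have "m mod 8 \<noteq> 5" using s16 m by presburger
    ultimately show ?thesis using ternary_represents_even_squarefree[of m] m by simp
  qed
  then obtain x z w where "int s = ternary x z w" by blast
  then have "int n = ternary (int u * x) (int u * z) (int u * w)"
    unfolding ternary_scale n_eq by simp
  then show ?thesis by blast
qed

text \<open>Exceptional numbers are 10, 8 or 0 modulo 16 according to \<open>k = 0\<close>,
  \<open>k = 1\<close> or \<open>k \<ge> 2\<close>.\<close>

lemma ternary_represents_mod_16:
  fixes n :: int
  assumes "n \<ge> 0" "n mod 16 \<notin> {0, 8, 10}"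
  shows "\<exists>x z w. n = ternary x z w"
proof -
  have "nat n \<noteq> 4 ^ k * (16 * m + 10)" for k m
  proof
    assume eq: "nat n = 4 ^ k * (16 * m + 10)"
    then have eq': "n = 4 ^ k * (16 * int m + 10)" using assms(1) by (metis int_nat_eq of_nat_add of_nat_mult of_nat_numeral of_nat_power)
    consider "k = 0" | "k = 1" | j where "k = j + 2" by (metis One_nat_def add_2_eq_Suc' not0_implies_Suc)
    then have "n mod 16 \<in> {0, 8, 10}"
    proof cases
      case 1
      then show ?thesis using eq' by simp
    next
      case 2
      then have "n = 40 + 64 * int m" using eq' by simp
      then have "n mod 16 = 8" by presburger
      then show ?thesis by simp
    next
      case 3
      then have "n = 16 * (4 ^ j * (16 * int m + 10))" using eq' by (simp add: power_add)
      then show ?thesis by simp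
    qed
    then show False using assms(2) by simp
  qed
  then show ?thesis using ternary_represents[of "nat n"] assms(1) by simp
qed

section \<open>The quaternary form\<close>

text \<open>Subtracting \<open>b\<close> leaves a residue from 1 to 7 if \<open>b\<close> is from 3
  to 9. For 2 and 10 it would leave 8 and 0, so \<open>4 * b\<close> is subtracted, leaving 2; with
  \<open>b = 10\<close> this needs \<open>m \<ge> 2\<close>, and 10 and 26 are written out.\<close>

lemma represents_16m_plus_10:
  fixes b m :: int
  assumes "b \<in> {2, 3, 4, 5, 6, 7, 8, 9, 10}" "m \<ge> 0"
  shows "\<exists>x y z w. 16 * m + 10 = ternary x z w + b * y\<^sup>2"
proof -
  have *: ?thesis if "16 * m + 10 - b * y\<^sup>2 \<ge> 0" "(16 * m + 10 - b * y\<^sup>2) mod 16 \<notin> {0, 8, 10}" for y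
    using ternary_represents_mod_16[OF that] by (metis diff_add_cancel)
  consider "b \<in> {3, 4, 5, 6, 7, 8, 9}" | "b = 2" | "b = 10" "m = 0" | "b = 10" "m = 1" | "b = 10" "m \<ge> 2"
    using assms by fastforce
  then show ?thesis
  proof cases
    case 1
    have "(16 * m + 10 - b) mod 16 = (10 - b) mod 16"
      by (metis add_diff_eq mod_mult_self4)
    then show ?thesis using *[of 1] 1 assms(2) by auto
  next
    case 2
    have "(16 * m + 10 - b * 2\<^sup>2) mod 16 = 2" using 2 by simp
    then show ?thesis using *[of 2] 2 assms(2) by simp
  next
    case 3
    then have "16 * m + 10 = ternary 0 0 0 + b * 1\<^sup>2" by (simp add: ternary_def)
    then show ?thesis by blast
  next
    case 4
    then have "16 * m + 10 = ternary 0 4 0 + b * 1\<^sup>2" by (simp add: ternary_def)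
    then show ?thesis by blast
  next
    case 5
    have "16 * m + 10 - b * 2\<^sup>2 = 2 + 16 * (m - 2)" using 5 by simp
    then have "(16 * m + 10 - b * 2\<^sup>2) mod 16 = 2" by (simp only: mod_mult_self2) simp
    then show ?thesis using *[of 2] 5 by simp
  qed
qed

text \<open>The factor \<open>4 ^ k\<close> is absorbed by scaling all four variables by
  \<open>2 ^ k\<close>.\<close>

lemma represents_nonneg:
  fixes b n :: int
  assumes b: "b \<in> {2, 3, 4, 5, 6, 7, 8, 9, 10}" and "n \<ge> 0"
  shows "\<exists>x y z w. n = ternary x z w + b * y\<^sup>2"
proof (cases "\<exists>k m. nat n = 4 ^ k * (16 * m + 10)")
  case False
  then obtain x z w where "int (nat n) = ternary x z w" using ternary_represents by blast
  then have "n = ternary x z w + b * 0\<^sup>2" using assms(2) by simp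
  then show ?thesis by blast
next
  case True
  then obtain k m where "nat n = 4 ^ k * (16 * m + 10)" by blast
  then have n: "n = 4 ^ k * (16 * int m + 10)" using assms(2) by (metis int_nat_eq of_nat_add of_nat_mult of_nat_numeral of_nat_power)
  obtain x y z w where "16 * int m + 10 = ternary x z w + b * y\<^sup>2"
    using represents_16m_plus_10[OF b, of "int m"] by auto
  then have "n = (2 ^ k)\<^sup>2 * (ternary x z w + b * y\<^sup>2)"
    unfolding n power2_two_power by simp
  also have "\<dots> = ternary (2 ^ k * x) (2 ^ k * z) (2 ^ k * w) + b * (2 ^ k * y)\<^sup>2"
    unfolding ternary_scale by (simp add: power_mult_distrib algebra_simps)
  finally show ?thesis by blast
qed

text \<open>Completing the square bounds the variables, and the remaining cases are checked one by
  one.\<close>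

lemma ternary_ne_10: "ternary x z w \<noteq> 10"
proof
  assume T: "ternary x z w = 10"
  have eq: "4 * (10 - 2 * x\<^sup>2) = (2 * z + w)\<^sup>2 + 3 * w\<^sup>2"
    using T by (simp add: ternary_def power2_eq_square algebra_simps)
  have "3 * W \<le> 40 \<and> 2 * X \<le> 10 \<and> S \<le> 40"
    if "4 * (10 - 2 * X) = S + 3 * W" "0 \<le> S" "0 \<le> W" "0 \<le> X" for S W X :: int
    using that by auto
  from this[OF eq] have bounds: "3 * w\<^sup>2 \<le> 40" "2 * x\<^sup>2 \<le> 10" "(2 * z + w)\<^sup>2 \<le> 40" by simp_all
  have "\<bar>w\<bar>\<^sup>2 < 4\<^sup>2" "\<bar>x\<bar>\<^sup>2 < 3\<^sup>2" using bounds by simp_all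
  then have "\<bar>w\<bar> < 4" "\<bar>x\<bar> < 3" by (auto intro: power2_less_imp_less)
  then have wx: "w \<in> {-3, -2, -1, 0, 1, 2, 3}" "x \<in> {-2, -1, 0, 1, 2}" by auto
  have "\<bar>2 * z + w\<bar>\<^sup>2 < 7\<^sup>2" using bounds(3) by simp
  then have "\<bar>2 * z + w\<bar> < 7" by (auto intro: power2_less_imp_less)
  then have "z \<in> {-4, -3, -2, -1, 0, 1, 2, 3, 4}" using \<open>\<bar>w\<bar> < 4\<close> by auto
  then show False
    using wx T unfolding ternary_def by (elim insertE emptyE; simp)
qed

theorem theorem3p7:
  fixes b :: int
  assumes "b \<ge> 2"
  shows "(\<forall>n::int. n \<ge> 0 \<longrightarrow>
            (\<exists>x y z w :: int. n = 2 * x^2 + b * y^2 + (z^2 + z * w + w^2)))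
         \<longleftrightarrow> b \<in> {2, 3, 4, 5, 6, 7, 8, 9, 10}"
proof
  assume "\<forall>n::int. n \<ge> 0 \<longrightarrow>
    (\<exists>x y z w :: int. n = 2 * x^2 + b * y^2 + (z^2 + z * w + w^2))"
  moreover have "(0::int) \<le> 10" by simp
  ultimately obtain x y z w :: int where eq: "10 = 2 * x^2 + b * y^2 + (z^2 + z * w + w^2)" by blast
  then have T: "10 = ternary x z w + b * y\<^sup>2" using eq by (simp add: ternary_def)
  \<comment> \<open>As \<open>ternary\<close> never takes the value 10, \<open>y\<close> is nonzero;
    then \<open>b \<le> b * y ^ 2 \<le> 10\<close> because \<open>ternary\<close> is
    nonnegative.\<close>
  have "y \<noteq> 0" using T ternary_ne_10[of x z w] by auto
  then have "1 \<le> y\<^sup>2" by (simp add: int_one_le_iff_zero_less)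
  then have "b * 1 \<le> b * y\<^sup>2" using assms by (intro mult_left_mono) auto
  moreover have "0 \<le> 4 * ternary x z w"
  proof -
    have "4 * ternary x z w = 8 * x\<^sup>2 + (2 * z + w)\<^sup>2 + 3 * w\<^sup>2"
      by (simp add: ternary_def power2_eq_square algebra_simps)
    then show ?thesis by simp
  qed
  ultimately have "b \<le> 10" using T by linarith
  then show "b \<in> {2, 3, 4, 5, 6, 7, 8, 9, 10}" using assms by auto
next
  assume b: "b \<in> {2, 3, 4, 5, 6, 7, 8, 9, 10}"
  show "\<forall>n::int. n \<ge> 0 \<longrightarrow>
    (\<exists>x y z w :: int. n = 2 * x^2 + b * y^2 + (z^2 + z * w + w^2))"
  proof (intro allI impI)
    fix n :: int
    assume "n \<ge> 0"
    then obtain x y z w where "n = ternary x z w + b * y\<^sup>2" using represents_nonneg[OF b] by blast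
    then have "n = 2 * x^2 + b * y^2 + (z^2 + z * w + w^2)" by (simp add: ternary_def)
    then show "\<exists>x y z w :: int. n = 2 * x^2 + b * y^2 + (z^2 + z * w + w^2)" by blast
  qed
qed

end
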